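(* Let $N\ge1$ be an integer, $p\in[2,\infty)$, and $\gamma:=\frac{2}{N(p-1)}$. Let $J:\mathbb{R}^N\to[0,+\infty)$ be smooth and radially symmetric with $J(0)>0$, and let $r,R>0$ be such that $J(z)\ge r$ for all $|z|<R$. Let $C(J)$ be defined by $C(J)^{-1}=\frac12\int_{\mathbb{R}^N}J(z)z_N^2\,dz$ (assumed finite), and for $\varepsilon>0$ let $$J_\varepsilon(z):=\frac{C(J)}{\varepsilon^{2+N}}\,J\!\left(\frac z\varepsilon\right),\qquad z\in\mathbb{R}^N.$$ Let $u_0\in L^1(\mathbb{R}^N)\cap L^p(\mathbb{R}^N)$ and let $u^\varepsilon$ be a solution of $$\partial_tu^\varepsilon(t,x)=\int_{\mathbb{R}^N}J_\varepsilon(x-y)\big(u^\varepsilon(t,y)-u^\varepsilon(t,x)\big)\,dy,\qquad x\in\mathbb{R}^N,\ t>0,$$ with initial data $u_0$. Then, with $C=C(N,p)>0$ the constant, depending only on $N$ and $p$, of the energy inequality recalled in the context, $$\|u^\varepsilon(t,\cdot)\|_p^p\le\Big(\|u_0\|_p^{-p\gamma}+C_1\,\|u_0\|_1^{-p\gamma}\,(t-t_0)\Big)^{-\frac1\gamma}\qquad\text{for }t\ge t_0,$$ where $C_1=C(N,p)\,\gamma\,r\,R^{N+2}\,C(J)$ does not depend on $\varepsilon$ and $$t_0=\max\left\{0,\ \frac{\varepsilon^2}{C\,r\,R^N\,C(J)}\log\left(\varepsilon^{\frac2\gamma}R^{\frac2\gamma}\,\|u_0\|_1^{-p}\,\|u_0\|_p^p\right)\right\}.$$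 In particular, $t_0=0$ for all $\varepsilon<\varepsilon_0=\|u_0\|_1^{\frac{\gamma p}{2}}\Big/\left(R\,\|u_0\|_p^{\frac{\gamma p}{2}}\right)$.
   Context: $\|\cdot\|_q$ denotes the norm of $L^q(\mathbb{R}^N)$; $z_N$ is the $N$-th coordinate of $z\in\mathbb{R}^N$. A solution is understood as a function $u^\varepsilon\in\mathcal{C}^1([0,+\infty),L^1(\mathbb{R}^N)\cap L^p(\mathbb{R}^N))$ satisfying the equation with $u^\varepsilon(0,\cdot)=u_0$. The energy inequality defining the constant $C=C(N,p)$: for every measurable $j:\mathbb{R}^N\to[0,+\infty)$ with $j(z)\ge \rho$ for $|z|<P$ (where $\rho,P>0$) and every $v\in L^1(\mathbb{R}^N)\cap L^p(\mathbb{R}^N)$, $$\mathcal{D}_p^j(v)\ge C\,\rho\,\min\left\{P^{N+2}\|v\|_1^{-p\gamma}\|v\|_p^{p(1+\gamma)},\,P^N\|v\|_p^p\right\},$$ where $$\mathcal{D}_p^j(v):=\frac p2\int_{\mathbb{R}^N}\int_{\mathbb{R}^N}j(x-y)(v(x)-v(y))\big(\phi_{p-1}(v(x))-\phi_{p-1}(v(y))\big)\,dx\,dy,\qquad \phi_q(s):=|s|^q\,\mathrm{sgn}(s).$$ *)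

theory Defs
  imports "HOL-Analysis.Analysis"
begin

text \<open>
  Elements of \<open>L\<^sup>q(\<real>\<^sup>N)\<close> are represented by Lebesgue measurable functions, and identities between
  them are required almost everywhere only.
\<close>

definition Lq_mem :: "real \<Rightarrow> (real^'n \<Rightarrow> real) \<Rightarrow> bool" where
  "Lq_mem q f \<longleftrightarrow> f \<in> borel_measurable lebesgue \<and> integrable lebesgue (\<lambda>x. \<bar>f x\<bar> powr q)"

definition Lq_norm :: "real \<Rightarrow> (real^'n \<Rightarrow> real) \<Rightarrow> real" where
  "Lq_norm q f = (LINT x|lebesgue. \<bar>f x\<bar> powr q) powr (1 / q)"

definition L1p_mem :: "real \<Rightarrow> (real^'n \<Rightarrow> real) \<Rightarrow> bool" where
  "L1p_mem p f \<longleftrightarrow> Lq_mem 1 f \<and> Lq_mem p f"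

definition L1p_norm :: "real \<Rightarrow> (real^'n \<Rightarrow> real) \<Rightarrow> real" where
  "L1p_norm p f = Lq_norm 1 f + Lq_norm p f"

definition phi :: "real \<Rightarrow> real \<Rightarrow> real" where
  "phi q s = \<bar>s\<bar> powr q * sgn s"

text \<open>
  The integrand of the energy is nonnegative but the double integral may be infinite, as \<open>j\<close> is only
  assumed measurable; the energy therefore takes values in \<open>[0,\<infinity>]\<close>.
\<close>

definition energy :: "real \<Rightarrow> (real^'n \<Rightarrow> real) \<Rightarrow> (real^'n \<Rightarrow> real) \<Rightarrow> ennreal" where
  "energy p j v = ennreal (p / 2) *
     (\<integral>\<^sup>+x. (\<integral>\<^sup>+y. ennreal (j (x - y) * (v x - v y) * (phi (p - 1) (v x) - phi (p - 1) (v y)))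
        \<partial>lebesgue) \<partial>lebesgue)"

definition energy_inequality :: "'n::finite itself \<Rightarrow> real \<Rightarrow> real \<Rightarrow> real \<Rightarrow> bool" where
  "energy_inequality _ p \<gamma> C \<longleftrightarrow>
     (\<forall>(j :: real^'n \<Rightarrow> real) v \<rho> P.
        j \<in> borel_measurable lebesgue \<and> (\<forall>z. 0 \<le> j z) \<and> 0 < \<rho> \<and> 0 < P \<and>
        (\<forall>z. norm z < P \<longrightarrow> \<rho> \<le> j z) \<and> L1p_mem p v \<longrightarrow>
        ennreal (C * \<rho> *
          min (P ^ (CARD('n) + 2) * Lq_norm 1 v powr (- p * \<gamma>) * Lq_norm p v powr (p * (1 + \<gamma>)))
              (P ^ CARD('n) * Lq_norm p v powr p))
        \<le> energy p j v)"

text \<open>\<open>C_k k f\<close>: all partial derivatives of \<open>f\<close> up to order \<open>k\<close> exist and are continuous.\<close>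

fun C_k :: "nat \<Rightarrow> (real^'n \<Rightarrow> real) \<Rightarrow> bool" where
  "C_k 0 f \<longleftrightarrow> continuous_on UNIV f"
| "C_k (Suc k) f \<longleftrightarrow> continuous_on UNIV f \<and>
     (\<forall>i. \<exists>g. (\<forall>x. ((\<lambda>h. f (x + h *\<^sub>R axis i 1)) has_real_derivative g x) (at 0)) \<and> C_k k g)"

definition smooth :: "(real^'n \<Rightarrow> real) \<Rightarrow> bool" where
  "smooth f \<longleftrightarrow> (\<forall>k. C_k k f)"

definition radially_symmetric :: "(real^'n \<Rightarrow> real) \<Rightarrow> bool" where
  "radially_symmetric f \<longleftrightarrow> (\<forall>x y. norm x = norm y \<longrightarrow> f x = f y)"

text \<open>
  The index type of \<open>real^'n\<close> has no distinguished last element, so the coordinate \<open>z\<^sub>N\<close> is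
  \<open>z $ k\<close> for an index \<open>k\<close>, over which the theorem quantifies universally.
\<close>

definition diffusivity :: "'n::finite \<Rightarrow> (real^'n \<Rightarrow> real) \<Rightarrow> real" where
  "diffusivity k J = inverse (1/2 * (LINT z|lebesgue. J z * (z $ k)\<^sup>2))"

definition rescaled_kernel :: "'n::finite \<Rightarrow> (real^'n \<Rightarrow> real) \<Rightarrow> real \<Rightarrow> real^'n \<Rightarrow> real" where
  "rescaled_kernel k J \<epsilon> z = diffusivity k J / \<epsilon> ^ (2 + CARD('n)) * J (z /\<^sub>R \<epsilon>)"

text \<open>
  \<open>L1p_C1 p u u'\<close>: the curve \<open>u\<close> is of class \<open>C\<^sup>1\<close> from \<open>[0,\<infinity>)\<close> to \<open>L\<^sup>1 \<inter> L\<^sup>p\<close>, normed by the sum of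
  the two norms, with derivative \<open>u'\<close> (one-sided at \<open>0\<close>).
\<close>

definition L1p_C1 :: "real \<Rightarrow> (real \<Rightarrow> real^'n \<Rightarrow> real) \<Rightarrow> (real \<Rightarrow> real^'n \<Rightarrow> real) \<Rightarrow> bool" where
  "L1p_C1 p u u' \<longleftrightarrow>
     (\<forall>t\<ge>0. L1p_mem p (u t) \<and> L1p_mem p (u' t) \<and>
        ((\<lambda>s. L1p_norm p (\<lambda>x. (u s x - u t x) / (s - t) - u' t x)) \<longlongrightarrow> 0) (at t within {0..}) \<and>
        ((\<lambda>s. L1p_norm p (\<lambda>x. u' s x - u' t x)) \<longlongrightarrow> 0) (at t within {0..}))"

definition nonlocal_solution ::
  "real \<Rightarrow> (real^'n \<Rightarrow> real) \<Rightarrow> (real^'n \<Rightarrow> real) \<Rightarrow> (real \<Rightarrow> real^'n \<Rightarrow> real) \<Rightarrow> bool" where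
  "nonlocal_solution p K u0 u \<longleftrightarrow>
     (\<exists>u'. L1p_C1 p u u' \<and>
        (\<forall>t>0. AE x in lebesgue. u' t x = (LINT y|lebesgue. K (x - y) * (u t y - u t x)))) \<and>
     (AE x in lebesgue. u 0 x = u0 x)"

end

theory Submission
  imports Defs
begin

text \<open>
  The energy inequality is a nonlocal Nash inequality. The Stroock--Varopoulos inequality bounds the
  energy from below by \<open>\<rho> / 2\<close> times the quadratic form
  \<open>Q(P) = \<integral>\<integral> |w(x) - w(y)|\<^sup>2 dx dy\<close> over \<open>|x - y| < P\<close>, where \<open>w = phi (p / 2) v\<close>, so that
  \<open>\<parallel>w\<parallel>\<^sub>2\<^sup>2 = \<parallel>v\<parallel>\<^sub>p\<^sup>p\<close>. Two elementary facts replace Fourier analysis. First,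
  \<open>a\<^sup>2 + b\<^sup>2 \<le> (a - b)\<^sup>2 + 2 |a| |b|\<close>, integrated over \<open>|x - y| < L\<close>, gives
  \<open>2 |B\<^sub>L| \<parallel>w\<parallel>\<^sub>2\<^sup>2 \<le> Q(L) + 2 \<parallel>w\<parallel>\<^sub>1\<^sup>2\<close>. Secondly, splitting an increment \<open>w(x + 2h) - w(x)\<close> at
  \<open>x + h\<close> gives \<open>Q(2L) \<le> 2 ^ (N + 2) * Q(L)\<close>, so large ranges are controlled by small ones.
  Choosing for \<open>L\<close> the first \<open>2 ^ m * P\<close> at which \<open>\<parallel>w\<parallel>\<^sub>1\<^sup>2\<close> can be absorbed yields
  \<open>interaction_Nash\<close>; the case \<open>m = 0\<close> is the second term of the minimum. Interpolating
  \<open>\<parallel>w\<parallel>\<^sub>1 = \<integral> |v| powr (p / 2)\<close> between the first and the \<open>p\<close>-th moment of \<open>|v|\<close> then produces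
  the exponents of the energy inequality.

  For the decay estimate, let \<open>F(t) = \<parallel>u(t)\<parallel>\<^sub>p\<^sup>p\<close>. Symmetrizing the double integral shows that
  \<open>p \<integral> phi (p - 1) u \<partial>\<^sub>tu\<close> is minus the energy (\<open>dissipation_identity\<close>), and this holds for every
  exponent \<open>q \<ge> 1\<close>, with \<open>phi 0 = sgn\<close> for \<open>q = 1\<close>. By convexity of \<open>|s| powr q\<close> the left Dini
  derivative of the \<open>q\<close>-th power of \<open>\<parallel>u(t)\<parallel>\<^sub>q\<close> is at most \<open>q \<integral> phi (q - 1) u \<partial>\<^sub>tu\<close>
  (\<open>Lq_pow_left_Dini\<close>). For \<open>q = 1\<close> this says that the mass does not increase; for \<open>q = p\<close> the energy
  inequality gives \<open>F' \<le> - min (A * F powr (1 + \<gamma>)) (B * F)\<close> in the Dini sense, with \<open>A\<close> and \<open>B\<close>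
  depending on the initial data through \<open>\<parallel>u\<^sub>0\<parallel>\<^sub>1\<close> only. Comparison with explicit supersolutions
  (\<open>decay_of_left_Dini\<close>) finishes the proof: \<open>F\<close> decays exponentially until time \<open>t\<^sub>0\<close>, at which
  \<open>F powr \<gamma> \<le> B / A\<close>, and algebraically from then on.
\<close>

section \<open>A Nash inequality for finite-range quadratic forms\<close>

lemma ball_in_sets_borel [measurable]: "ball c r \<in> sets borel"
  by simp

lemma nn_integral_lborel_translate:
  fixes f :: "'a::euclidean_space \<Rightarrow> ennreal"
  assumes [measurable]: "f \<in> borel_measurable borel"
  shows "(\<integral>\<^sup>+x. f (a + x) \<partial>lborel) = (\<integral>\<^sup>+x. f x \<partial>lborel)"
proof -
  have "(\<integral>\<^sup>+x. f x \<partial>lborel) = (\<integral>\<^sup>+x. f x \<partial>distr lborel borel ((+) a))"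
    by (simp add: lborel_distr_plus)
  also have "\<dots> = (\<integral>\<^sup>+x. f (a + x) \<partial>lborel)"
    by (rule nn_integral_distr) auto
  finally show ?thesis ..
qed

lemma nn_integral_lborel_scale:
  fixes f :: "'a::euclidean_space \<Rightarrow> ennreal"
  assumes [measurable]: "f \<in> borel_measurable borel" and "c \<noteq> 0"
  shows "(\<integral>\<^sup>+x. f x \<partial>lborel) = ennreal (\<bar>c\<bar> ^ DIM('a)) * (\<integral>\<^sup>+x. f (c *\<^sub>R x) \<partial>lborel)"
proof -
  have "(\<integral>\<^sup>+x. f x \<partial>lborel) =
      (\<integral>\<^sup>+x. f x \<partial>density (distr lborel borel (\<lambda>x. 0 + c *\<^sub>R x)) (\<lambda>_. \<bar>c\<bar> ^ DIM('a)))"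
    using lborel_affine[OF \<open>c \<noteq> 0\<close>, of "0::'a"] by simp
  also have "\<dots> = ennreal (\<bar>c\<bar> ^ DIM('a)) * (\<integral>\<^sup>+x. f (c *\<^sub>R x) \<partial>lborel)"
    by (subst nn_integral_density) (simp_all add: nn_integral_distr nn_integral_cmult)
  finally show ?thesis .
qed

text \<open>
  The quadratic form \<open>Q(L)\<close> of interactions of range \<open>L\<close>; it takes values in \<open>[0,\<infinity>]\<close>, so that no
  integrability has to be assumed.
\<close>

definition interaction :: "('a::euclidean_space \<Rightarrow> real) \<Rightarrow> real \<Rightarrow> ennreal" where
  "interaction w L =
     (\<integral>\<^sup>+x. (\<integral>\<^sup>+y. indicator (ball 0 L) (x - y) * ennreal ((w x - w y)\<^sup>2) \<partial>lborel) \<partial>lborel)"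

lemma interaction_eq_increments:
  fixes w :: "'a::euclidean_space \<Rightarrow> real"
  assumes [measurable]: "w \<in> borel_measurable borel"
  shows "interaction w L =
    (\<integral>\<^sup>+h. indicator (ball 0 L) h * (\<integral>\<^sup>+x. ennreal ((w (h + x) - w x)\<^sup>2) \<partial>lborel) \<partial>lborel)"
proof -
  have "interaction w L =
      (\<integral>\<^sup>+x. (\<integral>\<^sup>+h. indicator (ball 0 L) h * ennreal ((w (h + x) - w x)\<^sup>2) \<partial>lborel) \<partial>lborel)"
    unfolding interaction_def
  proof (rule nn_integral_cong)
    fix x :: 'a
    show "(\<integral>\<^sup>+y. indicator (ball 0 L) (x - y) * ennreal ((w x - w y)\<^sup>2) \<partial>lborel) =
        (\<integral>\<^sup>+h. indicator (ball 0 L) h * ennreal ((w (h + x) - w x)\<^sup>2) \<partial>lborel)"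
      using nn_integral_lborel_translate
          [of "\<lambda>y. indicator (ball 0 L) (x - y) * ennreal ((w x - w y)\<^sup>2)" x]
      by (simp add: indicator_def add.commute power2_commute)
  qed
  also have "\<dots> = (\<integral>\<^sup>+h. (\<integral>\<^sup>+x. indicator (ball 0 L) h * ennreal ((w (h + x) - w x)\<^sup>2) \<partial>lborel) \<partial>lborel)"
    by (rule lborel_pair.Fubini') simp
  finally show ?thesis
    by (simp add: nn_integral_cmult)
qed

text \<open>
  The factor \<open>2 ^ DIM('a)\<close> comes from the dilation of the domain of increments, the factor 4 from
  splitting an increment into two equal steps.
\<close>

lemma interaction_double:
  fixes w :: "'a::euclidean_space \<Rightarrow> real"
  assumes [measurable]: "w \<in> borel_measurable borel"
  shows "interaction w (2 * L) \<le> ennreal (2 ^ (DIM('a) + 2)) * interaction w L"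
proof -
  define G where "G h = (\<integral>\<^sup>+x. ennreal ((w (h + x) - w x)\<^sup>2) \<partial>lborel)" for h
  have [measurable]: "G \<in> borel_measurable borel"
    unfolding G_def by measurable
  have G2: "G (2 *\<^sub>R h) \<le> 4 * G h" for h
  proof -
    have "G (2 *\<^sub>R h) \<le>
        (\<integral>\<^sup>+x. 2 * ennreal ((w (h + (h + x)) - w (h + x))\<^sup>2) + 2 * ennreal ((w (h + x) - w x)\<^sup>2) \<partial>lborel)"
      unfolding G_def
    proof (intro nn_integral_mono)
      fix x
      have "(w (2 *\<^sub>R h + x) - w x)\<^sup>2 \<le> 2 * (w (h + (h + x)) - w (h + x))\<^sup>2 + 2 * (w (h + x) - w x)\<^sup>2"
        using sum_squares_bound[of "w (h + (h + x)) - w (h + x)" "w (h + x) - w x"]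
        by (simp add: scaleR_2 add.assoc power2_eq_square algebra_simps)
      from ennreal_leI[OF this]
      show "ennreal ((w (2 *\<^sub>R h + x) - w x)\<^sup>2) \<le>
          2 * ennreal ((w (h + (h + x)) - w (h + x))\<^sup>2) + 2 * ennreal ((w (h + x) - w x)\<^sup>2)"
        by (simp add: ennreal_mult)
    qed
    also have "\<dots> = 2 * (\<integral>\<^sup>+x. ennreal ((w (h + (h + x)) - w (h + x))\<^sup>2) \<partial>lborel) + 2 * G h"
      unfolding G_def by (simp add: nn_integral_add nn_integral_cmult)
    also have "(\<integral>\<^sup>+x. ennreal ((w (h + (h + x)) - w (h + x))\<^sup>2) \<partial>lborel) = G h"
      unfolding G_def by (rule nn_integral_lborel_translate) simp
    also have "2 * G h + 2 * G h = 4 * G h"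
      by (simp flip: distrib_right)
    finally show ?thesis .
  qed
  have "interaction w (2 * L) = (\<integral>\<^sup>+h. indicator (ball 0 (2 * L)) h * G h \<partial>lborel)"
    by (simp add: interaction_eq_increments G_def)
  also have "\<dots> = ennreal (2 ^ DIM('a)) *
      (\<integral>\<^sup>+h. indicator (ball 0 (2 * L)) (2 *\<^sub>R h) * G (2 *\<^sub>R h) \<partial>lborel)"
    using nn_integral_lborel_scale[of "\<lambda>h. indicator (ball 0 (2 * L)) h * G h" 2] by simp
  also have "\<dots> \<le> ennreal (2 ^ DIM('a)) * (\<integral>\<^sup>+h. 4 * (indicator (ball 0 L) h * G h) \<partial>lborel)"
    using G2 by (intro mult_left_mono nn_integral_mono) (auto simp: indicator_def)
  also have "\<dots> = ennreal (2 ^ DIM('a)) * (4 * interaction w L)"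
    by (simp add: nn_integral_cmult interaction_eq_increments G_def)
  also have "\<dots> = ennreal (2 ^ (DIM('a) + 2)) * interaction w L"
    by (simp add: power_add ennreal_mult mult_ac)
  finally show ?thesis .
qed

lemma interaction_dyadic:
  fixes w :: "'a::euclidean_space \<Rightarrow> real"
  assumes [measurable]: "w \<in> borel_measurable borel"
  shows "interaction w (2 ^ m * L) \<le> ennreal ((2 ^ m) ^ (DIM('a) + 2)) * interaction w L"
proof (induction m)
  case (Suc m)
  have "interaction w (2 ^ Suc m * L) \<le> ennreal (2 ^ (DIM('a) + 2)) * interaction w (2 ^ m * L)"
    using interaction_double[OF assms, of "2 ^ m * L"] by (simp add: mult.assoc)
  also have "\<dots> \<le> ennreal (2 ^ (DIM('a) + 2)) * (ennreal ((2 ^ m) ^ (DIM('a) + 2)) * interaction w L)"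
    by (intro mult_left_mono Suc.IH) simp
  also have "\<dots> = ennreal ((2 ^ Suc m) ^ (DIM('a) + 2)) * interaction w L"
    by (simp only: mult.assoc[symmetric] power_Suc power_mult_distrib) (simp add: ennreal_mult)
  finally show ?case .
qed simp

lemma nn_integral_ball_kernel:
  fixes f :: "'a::euclidean_space \<Rightarrow> ennreal"
  assumes [measurable]: "f \<in> borel_measurable borel" and "0 \<le> L"
  shows "(\<integral>\<^sup>+x. (\<integral>\<^sup>+y. indicator (ball 0 L) (x - y) * f x \<partial>lborel) \<partial>lborel) =
      ennreal (unit_ball_vol (real DIM('a)) * L ^ DIM('a)) * (\<integral>\<^sup>+x. f x \<partial>lborel)" (is ?th1)
    and "(\<integral>\<^sup>+x. (\<integral>\<^sup>+y. indicator (ball 0 L) (x - y) * f y \<partial>lborel) \<partial>lborel) =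
      ennreal (unit_ball_vol (real DIM('a)) * L ^ DIM('a)) * (\<integral>\<^sup>+x. f x \<partial>lborel)" (is ?th2)
proof -
  have ind: "indicator (ball 0 L) (x - y) = (indicator (ball x L) y :: ennreal)" for x y :: 'a
    by (simp add: indicator_def dist_norm norm_minus_commute)
  have "(\<integral>\<^sup>+y. indicator (ball 0 L) (x - y) * f x \<partial>lborel) =
      ennreal (unit_ball_vol (real DIM('a)) * L ^ DIM('a)) * f x" for x
    by (subst ind, subst nn_integral_multc) (simp_all add: emeasure_ball \<open>0 \<le> L\<close>)
  then show ?th1
    by (simp add: nn_integral_cmult)
  also have "(\<integral>\<^sup>+x. (\<integral>\<^sup>+y. indicator (ball 0 L) (x - y) * f x \<partial>lborel) \<partial>lborel) =
      (\<integral>\<^sup>+y. (\<integral>\<^sup>+x. indicator (ball 0 L) (x - y) * f x \<partial>lborel) \<partial>lborel)"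
    by (rule lborel_pair.Fubini') simp
  also have "\<dots> = (\<integral>\<^sup>+x. (\<integral>\<^sup>+y. indicator (ball 0 L) (x - y) * f y \<partial>lborel) \<partial>lborel)"
    by (intro nn_integral_cong) (simp only: ind, simp only: indicator_def mem_ball dist_commute)
  finally show ?th2 .
qed

lemma L2_le_interaction:
  fixes w :: "'a::euclidean_space \<Rightarrow> real"
  assumes [measurable]: "w \<in> borel_measurable borel" and "0 \<le> L"
  shows "2 * (ennreal (unit_ball_vol (real DIM('a)) * L ^ DIM('a)) * (\<integral>\<^sup>+x. ennreal ((w x)\<^sup>2) \<partial>lborel)) \<le>
    interaction w L + 2 * (\<integral>\<^sup>+x. ennreal \<bar>w x\<bar> \<partial>lborel)\<^sup>2"
proof -
  let ?I = "\<lambda>x y. indicator (ball 0 L) (x - y :: 'a) :: ennreal"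
  have "2 * (ennreal (unit_ball_vol (real DIM('a)) * L ^ DIM('a)) * (\<integral>\<^sup>+x. ennreal ((w x)\<^sup>2) \<partial>lborel)) =
      (\<integral>\<^sup>+x. (\<integral>\<^sup>+y. ?I x y * ennreal ((w x)\<^sup>2) + ?I x y * ennreal ((w y)\<^sup>2) \<partial>lborel) \<partial>lborel)"
    by (simp add: nn_integral_add nn_integral_ball_kernel \<open>0 \<le> L\<close> mult_2)
  also have "\<dots> \<le> (\<integral>\<^sup>+x. (\<integral>\<^sup>+y. ?I x y * ennreal ((w x - w y)\<^sup>2) +
      2 * (ennreal \<bar>w x\<bar> * ennreal \<bar>w y\<bar>) \<partial>lborel) \<partial>lborel)"
  proof (intro nn_integral_mono)
    fix x y
    have "(w x)\<^sup>2 + (w y)\<^sup>2 \<le> (w x - w y)\<^sup>2 + 2 * (\<bar>w x\<bar> * \<bar>w y\<bar>)"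
      using abs_ge_self[of "w x * w y"] by (simp add: power2_diff abs_mult)
    from ennreal_leI[OF this]
    have "ennreal ((w x)\<^sup>2) + ennreal ((w y)\<^sup>2) \<le> ennreal ((w x - w y)\<^sup>2) + 2 * (ennreal \<bar>w x\<bar> * ennreal \<bar>w y\<bar>)"
      by (simp add: ennreal_mult)
    then show "?I x y * ennreal ((w x)\<^sup>2) + ?I x y * ennreal ((w y)\<^sup>2) \<le>
        ?I x y * ennreal ((w x - w y)\<^sup>2) + 2 * (ennreal \<bar>w x\<bar> * ennreal \<bar>w y\<bar>)"
      by (simp add: indicator_def)
  qed
  also have "\<dots> = interaction w L + 2 * (\<integral>\<^sup>+x. ennreal \<bar>w x\<bar> \<partial>lborel)\<^sup>2"
    unfolding interaction_def
    by (simp add: nn_integral_add nn_integral_cmult nn_integral_multc power2_eq_square)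
  finally show ?thesis .
qed

text \<open>
  For \<open>S = \<parallel>w\<parallel>\<^sub>2\<^sup>2\<close> and an upper bound \<open>W\<close> of \<open>\<parallel>w\<parallel>\<^sub>1\<close> this is
  \<open>Q(P) \<ge> c * min (P ^ N * S) (P ^ (N + 2) * S * (S / W\<^sup>2) powr (2 / N))\<close> with explicit \<open>c\<close>.
\<close>

lemma interaction_Nash:
  fixes w :: "'a::euclidean_space \<Rightarrow> real" and S W P :: real
  defines "\<omega> \<equiv> unit_ball_vol (real DIM('a))"
  assumes [measurable]: "w \<in> borel_measurable borel"
    and S: "(\<integral>\<^sup>+x. ennreal ((w x)\<^sup>2) \<partial>lborel) = ennreal S" "0 < S"
    and W: "(\<integral>\<^sup>+x. ennreal \<bar>w x\<bar> \<partial>lborel) \<le> ennreal W" "0 < W"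
    and "0 < P"
  shows "ennreal (\<omega> * P ^ DIM('a) * S *
      min 1 (P\<^sup>2 / (4 * (2 * W\<^sup>2 / (\<omega> * S)) powr (2 / real DIM('a))))) \<le> interaction w P"
proof -
  define N where "N = DIM('a)"
  have N: "0 < N"
    by (simp add: N_def)
  have \<omega>: "0 < \<omega>"
    by (simp add: \<omega>_def)
  define K where "K = 2 * W\<^sup>2 / (\<omega> * S)"
  have K: "0 < K"
    using \<omega> S W by (simp add: K_def)
  \<comment> \<open>A range \<open>L = 2 ^ m * P\<close> with \<open>K \<le> L ^ N\<close> is large enough to absorb the \<open>L\<^sup>1\<close> term.\<close>
  have scale: "ennreal (\<omega> * P ^ N * S * (1 / (2 ^ m)\<^sup>2)) \<le> interaction w P" if m: "K \<le> (2 ^ m * P) ^ N" for m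
  proof -
    let ?L = "2 ^ m * P"
    have "2 * W\<^sup>2 \<le> \<omega> * ?L ^ N * S"
      using m \<omega> S by (simp add: K_def field_simps)
    have "ennreal (\<omega> * ?L ^ N * S) + ennreal (\<omega> * ?L ^ N * S) = 2 * (ennreal (\<omega> * ?L ^ N) * ennreal S)"
      using \<omega> S \<open>0 < P\<close> by (simp add: ennreal_mult mult_2)
    also have "\<dots> \<le> interaction w ?L + 2 * (\<integral>\<^sup>+x. ennreal \<bar>w x\<bar> \<partial>lborel)\<^sup>2"
      using L2_le_interaction[of w ?L] \<open>0 < P\<close> by (simp add: S \<omega>_def N_def)
    also have "\<dots> \<le> interaction w ?L + ennreal (2 * W\<^sup>2)"
      using W by (simp add: ennreal_mult ennreal_power[symmetric] power_mono mult_left_mono add_left_mono)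
    also have "\<dots> \<le> interaction w ?L + ennreal (\<omega> * ?L ^ N * S)"
      using \<open>2 * W\<^sup>2 \<le> \<omega> * ?L ^ N * S\<close> by (intro add_left_mono ennreal_leI)
    finally have "ennreal (\<omega> * ?L ^ N * S) \<le> interaction w ?L"
      by (simp add: ennreal_add_left_cancel_le add.commute)
    also have "\<dots> \<le> ennreal ((2 ^ m) ^ (N + 2)) * interaction w P"
      unfolding N_def by (rule interaction_dyadic) simp
    finally have *: "ennreal (\<omega> * ?L ^ N * S) \<le> ennreal ((2 ^ m) ^ (N + 2)) * interaction w P" .
    have "ennreal (\<omega> * P ^ N * S * (1 / (2 ^ m)\<^sup>2)) = ennreal (1 / (2 ^ m) ^ (N + 2)) * ennreal (\<omega> * ?L ^ N * S)"
      using \<omega> S \<open>0 < P\<close>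
      by (subst ennreal_mult[symmetric]) (auto simp: power_add power_mult_distrib field_simps power2_eq_square)
    also have "\<dots> \<le> ennreal (1 / (2 ^ m) ^ (N + 2)) * (ennreal ((2 ^ m) ^ (N + 2)) * interaction w P)"
      by (intro mult_left_mono *) simp
    also have "\<dots> = interaction w P"
      by (simp only: mult.assoc[symmetric]) (subst ennreal_mult[symmetric], auto)
    finally show ?thesis .
  qed
  have "\<exists>m. K \<le> (2 ^ m * P) ^ N"
  proof -
    obtain m where "max 1 K / P < 2 ^ m"
      using real_arch_pow[of 2 "max 1 K / P"] by auto
    then have "max 1 K < 2 ^ m * P"
      using \<open>0 < P\<close> by (simp add: field_simps)
    moreover have "2 ^ m * P \<le> (2 ^ m * P) ^ N"
      using \<open>max 1 K < 2 ^ m * P\<close> N by (intro self_le_power) auto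
    ultimately show ?thesis
      by (intro exI[of _ m]) linarith
  qed
  \<comment> \<open>Minimality of \<open>m\<close> bounds \<open>2 ^ m\<close> from above: half of the range violates the condition.\<close>
  define m where "m = (LEAST m. K \<le> (2 ^ m * P) ^ N)"
  have m: "K \<le> (2 ^ m * P) ^ N"
    unfolding m_def by (rule LeastI_ex) fact
  have "min 1 (P\<^sup>2 / (4 * K powr (2 / real N))) \<le> 1 / (2 ^ m)\<^sup>2"
  proof (cases m)
    case 0
    then show ?thesis by simp
  next
    case (Suc n)
    then have "(2 ^ n * P) ^ N < K"
      using not_less_Least[of n "\<lambda>m. K \<le> (2 ^ m * P) ^ N"] by (simp add: m_def)
    then have "((2 ^ n * P) ^ N) powr (2 / real N) < K powr (2 / real N)"
      using N \<open>0 < P\<close> by (intro powr_less_mono2) auto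
    moreover have "((2 ^ n * P) ^ N) powr (2 / real N) = (2 ^ n * P)\<^sup>2"
    proof -
      have "0 < 2 ^ n * P"
        using \<open>0 < P\<close> by simp
      then have "((2 ^ n * P) ^ N) powr (2 / real N) = (2 ^ n * P) powr (real N * (2 / real N))"
        by (simp only: powr_realpow[symmetric] powr_powr)
      also have "\<dots> = (2 ^ n * P)\<^sup>2"
        using N \<open>0 < 2 ^ n * P\<close> by simp
      finally show ?thesis .
    qed
    ultimately have "(2 ^ m * P)\<^sup>2 \<le> 4 * K powr (2 / real N)"
      by (simp add: Suc power_mult_distrib)
    then have "P\<^sup>2 / (4 * K powr (2 / real N)) \<le> 1 / (2 ^ m)\<^sup>2"
      using K by (simp add: field_simps power_mult_distrib)
    then show ?thesis by simp
  qed
  then have "\<omega> * P ^ N * S * min 1 (P\<^sup>2 / (4 * K powr (2 / real N))) \<le> \<omega> * P ^ N * S * (1 / (2 ^ m)\<^sup>2)"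
    using \<omega> S \<open>0 < P\<close> by (intro mult_left_mono) auto
  from ennreal_leI[OF this] scale[OF m] show ?thesis
    unfolding K_def N_def by (rule order_trans)
qed

section \<open>The energy inequality\<close>

lemma abs_phi: "\<bar>phi q s\<bar> = \<bar>s\<bar> powr q"
  by (simp add: phi_def abs_mult sgn_if)

lemma phi_0 [simp]: "phi q 0 = 0"
  by (simp add: phi_def)

lemma phi_minus [simp]: "phi q (- s) = - phi q s"
  by (simp add: phi_def sgn_minus)

lemma phi_nonneg_eq: "0 \<le> s \<Longrightarrow> phi q s = s powr q"
  by (simp add: phi_def sgn_if)

lemma phi_mono:
  assumes "0 \<le> q" "a \<le> b"
  shows "phi q a \<le> phi q b"
proof -
  consider "0 \<le> a" | "a \<le> 0" "0 \<le> b" | "b \<le> 0"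
    using assms by linarith
  then show ?thesis
  proof cases
    case 1
    then show ?thesis
      using assms by (simp add: phi_nonneg_eq powr_mono2)
  next
    case 2
    then have "phi q a \<le> 0" "0 \<le> phi q b"
      by (auto simp: phi_def sgn_if)
    then show ?thesis by linarith
  next
    case 3
    then have "phi q (- b) \<le> phi q (- a)"
      using assms by (simp only: phi_nonneg_eq neg_0_le_iff_le) (auto intro!: powr_mono2)
    then show ?thesis by simp
  qed
qed

lemma phi_mult_nonneg:
  assumes "0 \<le> q"
  shows "0 \<le> (a - b) * (phi q a - phi q b)"
  using phi_mono[OF assms, of a b] phi_mono[OF assms, of b a]
  by (cases "a \<le> b") (auto intro: mult_nonneg_nonneg mult_nonpos_nonpos)

lemma phi_mult_self: "phi (q - 1) s * s = \<bar>s\<bar> powr q"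
proof (cases "s = 0")
  case False
  then have "phi (q - 1) s * s = \<bar>s\<bar> powr (q - 1) * \<bar>s\<bar> powr 1"
    by (simp add: phi_def sgn_if)
  also have "\<dots> = \<bar>s\<bar> powr q"
    by (subst powr_add[symmetric]) simp
  finally show ?thesis .
qed simp

lemma borel_measurable_phi [measurable]: "phi q \<in> borel_measurable borel"
  unfolding phi_def by measurable

text \<open>
  The Stroock--Varopoulos inequality with a non-optimal constant; it reduces the energy to a
  quadratic form in \<open>phi (p / 2) v\<close>.
\<close>

lemma Stroock_Varopoulos:
  assumes "2 \<le> p"
  shows "(phi (p / 2) a - phi (p / 2) b)\<^sup>2 \<le> p * ((a - b) * (phi (p - 1) a - phi (p - 1) b))"
proof -
  define \<sigma> where "\<sigma> = p / 2"
  have \<sigma>: "1 \<le> \<sigma>" "p = 2 * \<sigma>"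
    using assms by (auto simp: \<sigma>_def)
  \<comment> \<open>Arguments of equal sign: one factor of the square by the mean value theorem, one by monotonicity.\<close>
  have same: "(x powr \<sigma> - y powr \<sigma>)\<^sup>2 \<le> p * ((x - y) * (x powr (p - 1) - y powr (p - 1)))"
    if "0 \<le> y" "y \<le> x" "0 < x" for x y
  proof -
    have 1: "x powr \<sigma> - y powr \<sigma> \<le> \<sigma> * (x powr (\<sigma> - 1) * (x - y))"
    proof (cases "y = 0")
      case True
      have "x powr \<sigma> = x powr (\<sigma> - 1) * x"
        using that by (metis add.commute diff_add_cancel powr_add powr_one order_less_imp_le mult.commute)
      moreover have "0 \<le> x powr (\<sigma> - 1) * x"
        using that by simp
      ultimately show ?thesis
        using \<sigma> True mult_right_mono[of 1 \<sigma> "x powr (\<sigma> - 1) * x"] by simp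
    next
      case False
      show ?thesis
      proof (cases "x = y")
        case neq: False
        then have "y < x" "0 < y"
          using that False by auto
        have "\<exists>z>y. z < x \<and> x powr \<sigma> - y powr \<sigma> = (x - y) * (\<sigma> * z powr (\<sigma> - 1))"
        proof (rule MVT2[OF \<open>y < x\<close>])
          fix z assume "y \<le> z" "z \<le> x"
          then show "((\<lambda>z. z powr \<sigma>) has_real_derivative \<sigma> * z powr (\<sigma> - 1)) (at z)"
            using \<open>0 < y\<close> by (auto intro!: derivative_eq_intros simp: powr_diff field_simps)
        qed
        then obtain z where z: "y < z" "z < x" "x powr \<sigma> - y powr \<sigma> = (x - y) * (\<sigma> * z powr (\<sigma> - 1))"
          by blast
        have "z powr (\<sigma> - 1) \<le> x powr (\<sigma> - 1)"
          using z \<sigma> \<open>0 < y\<close> by (intro powr_mono2) auto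
        then have "(\<sigma> * (x - y)) * z powr (\<sigma> - 1) \<le> (\<sigma> * (x - y)) * x powr (\<sigma> - 1)"
          using \<sigma> \<open>y < x\<close> by (intro mult_left_mono) auto
        then show ?thesis
          using z by (simp add: mult_ac)
      qed simp
    qed
    have 2: "x powr (\<sigma> - 1) * (x powr \<sigma> - y powr \<sigma>) \<le> x powr (p - 1) - y powr (p - 1)"
    proof -
      have "y powr (p - 1) = y powr (\<sigma> - 1) * y powr \<sigma>" "x powr (p - 1) = x powr (\<sigma> - 1) * x powr \<sigma>"
        by (simp_all add: powr_add[symmetric] \<sigma>)
      moreover have "y powr (\<sigma> - 1) * y powr \<sigma> \<le> x powr (\<sigma> - 1) * y powr \<sigma>"
        using that \<sigma> by (intro mult_right_mono powr_mono2) auto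
      ultimately show ?thesis
        by (simp add: right_diff_distrib)
    qed
    have "0 \<le> x powr \<sigma> - y powr \<sigma>"
      using that \<sigma> by (simp add: powr_mono2)
    then have "(x powr \<sigma> - y powr \<sigma>)\<^sup>2 \<le> \<sigma> * (x powr (\<sigma> - 1) * (x - y)) * (x powr \<sigma> - y powr \<sigma>)"
      unfolding power2_eq_square by (intro mult_right_mono 1)
    also have "\<dots> = \<sigma> * (x - y) * (x powr (\<sigma> - 1) * (x powr \<sigma> - y powr \<sigma>))"
      by (simp add: mult_ac)
    also have "\<dots> \<le> \<sigma> * (x - y) * (x powr (p - 1) - y powr (p - 1))"
      using \<sigma> that by (intro mult_left_mono 2) auto
    also have "\<dots> \<le> p * (x - y) * (x powr (p - 1) - y powr (p - 1))"
      using \<sigma> that by (intro mult_right_mono) (auto intro: powr_mono2)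
    finally show ?thesis by (simp add: mult_ac)
  qed
  \<comment> \<open>Arguments \<open>x\<close> and \<open>- y\<close> of opposite sign.\<close>
  have opp: "(x powr \<sigma> + y powr \<sigma>)\<^sup>2 \<le> p * ((x + y) * (x powr (p - 1) + y powr (p - 1)))"
    if "0 \<le> x" "0 \<le> y" for x y
  proof -
    have sq: "z powr p = (z powr \<sigma>)\<^sup>2" "z powr p = z * z powr (p - 1)" if "0 \<le> z" for z :: real
    proof -
      show "z powr p = (z powr \<sigma>)\<^sup>2"
        by (simp add: \<sigma> power2_eq_square powr_add[symmetric])
      show "z powr p = z * z powr (p - 1)"
        using that powr_add[of z 1 "p - 1"] by simp
    qed
    have "(x powr \<sigma> + y powr \<sigma>)\<^sup>2 \<le> 2 * (x powr p + y powr p)"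
      using that sum_squares_bound[of "x powr \<sigma>" "y powr \<sigma>"] by (simp add: sq(1) power2_sum)
    also have "\<dots> \<le> 2 * ((x + y) * (x powr (p - 1) + y powr (p - 1)))"
      using that by (simp add: sq(2) algebra_simps)
    also have "\<dots> \<le> p * ((x + y) * (x powr (p - 1) + y powr (p - 1)))"
      using that assms by (intro mult_right_mono) auto
    finally show ?thesis .
  qed
  define Q where "Q a b \<longleftrightarrow> (phi \<sigma> a - phi \<sigma> b)\<^sup>2 \<le> p * ((a - b) * (phi (p - 1) a - phi (p - 1) b))" for a b
  have Q_nonneg: "Q a b" if "0 \<le> b" "b \<le> a" for a b
    using that same[of b a] by (cases "a = 0") (auto simp: Q_def phi_nonneg_eq)
  have Q_opp: "Q a b" if "b \<le> 0" "0 \<le> a" for a b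
  proof -
    have "phi q b = - ((- b) powr q)" for q
      using phi_nonneg_eq[of "- b" q] that by simp
    then show ?thesis
      using opp[of a "- b"] that by (simp add: Q_def phi_nonneg_eq)
  qed
  have Q_neg: "Q a b" if "Q (- b) (- a)" for a b
    using that by (simp add: Q_def power2_eq_square algebra_simps)
  have Q_sym: "Q a b" if "Q b a" for a b
    using that by (simp add: Q_def power2_eq_square algebra_simps)
  have "Q a b"
  proof (cases "b \<le> a")
    case True
    then consider "0 \<le> b" | "b \<le> 0" "0 \<le> a" | "a \<le> 0" by linarith
    then show ?thesis
      using True Q_nonneg Q_opp Q_neg[OF Q_nonneg[of "- a" "- b"]] by cases auto
  next
    case False
    then consider "0 \<le> a" | "a \<le> 0" "0 \<le> b" | "b \<le> 0" by linarith
    then show ?thesis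
      using False Q_nonneg[of a b] Q_opp[of a b] Q_neg[OF Q_nonneg[of "- b" "- a"]] 
      by cases (auto intro: Q_sym)
  qed
  then show ?thesis
    by (simp add: Q_def \<sigma>_def)
qed

text \<open>
  The \<open>q\<close>-th power of the \<open>L\<^sup>q\<close> norm. It is this power, not the norm, whose decay rate
  along a solution is the energy.
\<close>

definition Lq_pow :: "real \<Rightarrow> (real^'n \<Rightarrow> real) \<Rightarrow> real" where
  "Lq_pow q f = (LINT x|lebesgue. \<bar>f x\<bar> powr q)"

lemma Lq_pow_nonneg [simp]: "0 \<le> Lq_pow q f"
  by (simp add: Lq_pow_def)

lemma Lq_norm_eq: "Lq_norm q f = Lq_pow q f powr (1 / q)"
  by (simp add: Lq_norm_def Lq_pow_def)

lemma Lq_norm_1 [simp]: "Lq_norm 1 f = Lq_pow 1 f"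
  by (simp add: Lq_norm_eq)

lemma Lq_norm_powr:
  assumes "0 < q"
  shows "Lq_norm q f powr (q * a) = Lq_pow q f powr a"
  using assms by (simp add: Lq_norm_eq powr_powr)

lemma Lq_pow_eq_0_iff:
  assumes "Lq_mem q f"
  shows "Lq_pow q f = 0 \<longleftrightarrow> (AE x in lebesgue. f x = 0)"
  unfolding Lq_pow_def using assms
  by (subst integral_nonneg_eq_0_iff_AE) (auto simp: Lq_mem_def)

text \<open>
  Borel representatives make \<open>(x, y) \<mapsto> v (x + y)\<close> jointly measurable, which may fail for functions that are
  only Lebesgue measurable.
\<close>

lemma Lq_mem_borel_representative:
  fixes f :: "real^'n \<Rightarrow> real"
  assumes "f \<in> borel_measurable lebesgue"
  obtains g where "g \<in> borel_measurable borel" "AE x in lborel. f x = g x"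
  using completion_ex_borel_measurable_real[OF assms] by auto

lemma energy_cong_AE:
  fixes v v' :: "real^'n \<Rightarrow> real"
  assumes "AE x in lborel. v x = v' x"
  shows "energy p j v = energy p j v'"
  unfolding energy_def nn_integral_completion
proof (intro arg_cong[where f = "(*) _"] nn_integral_cong_AE)
  show "AE x in lborel.
      (\<integral>\<^sup>+y. ennreal (j (x - y) * (v x - v y) * (phi (p - 1) (v x) - phi (p - 1) (v y))) \<partial>lborel) =
      (\<integral>\<^sup>+y. ennreal (j (x - y) * (v' x - v' y) * (phi (p - 1) (v' x) - phi (p - 1) (v' y))) \<partial>lborel)"
    using assms
  proof eventually_elim
    case (elim x)
    show ?case
      using assms by (intro nn_integral_cong_AE) (auto simp: elim)
  qed
qed

lemma Lq_mem_cong_AE: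
  fixes v v' :: "real^'n \<Rightarrow> real"
  assumes "AE x in lborel. v x = v' x" "Lq_mem q v" "v' \<in> borel_measurable borel"
  shows "Lq_mem q v'" "Lq_pow q v' = Lq_pow q v" "integrable lborel (\<lambda>x. \<bar>v' x\<bar> powr q)"
    "Lq_pow q v = (LINT x|lborel. \<bar>v' x\<bar> powr q)"
proof -
  have ae: "AE x in lebesgue. v x = v' x"
    using assms(1) by (rule AE_completion)
  have [measurable]: "v' \<in> borel_measurable borel" "v \<in> borel_measurable lebesgue"
    using assms by (auto simp: Lq_mem_def)
  have v': "v' \<in> borel_measurable lebesgue"
    using assms(3) by (auto intro: measurable_completion)
  have "integrable lebesgue (\<lambda>x. \<bar>v' x\<bar> powr q) \<longleftrightarrow> integrable lebesgue (\<lambda>x. \<bar>v x\<bar> powr q)"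
    using ae v' by (intro integrable_cong_AE) auto
  then show mem: "Lq_mem q v'"
    using assms v' by (auto simp: Lq_mem_def)
  show eq: "Lq_pow q v' = Lq_pow q v"
    unfolding Lq_pow_def using ae v' by (intro integral_cong_AE) auto
  have m: "(\<lambda>x. \<bar>v' x\<bar> powr q) \<in> borel_measurable lborel"
    by simp
  show "integrable lborel (\<lambda>x. \<bar>v' x\<bar> powr q)"
    using mem integrable_completion[OF m] by (simp add: Lq_mem_def)
  show "Lq_pow q v = (LINT x|lborel. \<bar>v' x\<bar> powr q)"
    using integral_completion[OF m] eq by (simp add: Lq_pow_def)
qed

lemma energy_ge_interaction:
  fixes v :: "real^'n \<Rightarrow> real"
  assumes "2 \<le> p" and "0 < \<rho>" and "\<And>z. 0 \<le> j z" and j: "\<And>z. norm z < P \<Longrightarrow> \<rho> \<le> j z"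
    and [measurable]: "v \<in> borel_measurable borel"
  shows "ennreal (\<rho> / 2) * interaction (\<lambda>x. phi (p / 2) (v x)) P \<le> energy p j v"
proof -
  let ?w = "\<lambda>x. phi (p / 2) (v x)"
  have "(\<integral>\<^sup>+x. (\<integral>\<^sup>+y. ennreal (\<rho> / p) *
        (indicator (ball 0 P) (x - y) * ennreal ((?w x - ?w y)\<^sup>2)) \<partial>lborel) \<partial>lborel) =
      ennreal (\<rho> / p) * interaction ?w P"
    unfolding interaction_def by (simp add: nn_integral_cmult)
  moreover have "ennreal (p / 2) * (ennreal (\<rho> / p) * interaction ?w P) = ennreal (\<rho> / 2) * interaction ?w P"
    using assms(1,2) by (simp add: mult.assoc[symmetric] ennreal_mult[symmetric])
  ultimately have "ennreal (\<rho> / 2) * interaction ?w P = ennreal (p / 2) *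
     (\<integral>\<^sup>+x. (\<integral>\<^sup>+y. ennreal (\<rho> / p) *
        (indicator (ball 0 P) (x - y) * ennreal ((?w x - ?w y)\<^sup>2)) \<partial>lborel) \<partial>lborel)"
    by simp
  also have "\<dots> \<le> energy p j v"
    unfolding energy_def nn_integral_completion
  proof (intro mult_left_mono nn_integral_mono)
    fix x y
    let ?E = "(v x - v y) * (phi (p - 1) (v x) - phi (p - 1) (v y))"
    have E: "0 \<le> ?E" "(?w x - ?w y)\<^sup>2 \<le> p * ?E"
      using Stroock_Varopoulos[OF assms(1)] phi_mult_nonneg[of "p - 1"] assms(1) by auto
    have "indicator (ball 0 P) (x - y) * (?w x - ?w y)\<^sup>2 * (\<rho> / p) \<le> j (x - y) * ?E"
    proof (cases "norm (x - y) < P")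
      case True
      have "(?w x - ?w y)\<^sup>2 * (\<rho> / p) \<le> p * ?E * (\<rho> / p)"
        using assms(1,2) E by (intro mult_right_mono) auto
      also have "\<dots> = \<rho> * ?E"
        using assms(1) by simp
      also have "\<dots> \<le> j (x - y) * ?E"
        by (intro mult_right_mono j True E)
      finally show ?thesis
        using True by simp
    next
      case False
      have "0 \<le> j (x - y) * ?E"
        by (rule mult_nonneg_nonneg) (use assms(3) E in auto)
      then show ?thesis
        using False by simp
    qed
    from ennreal_leI[OF this]
    show "ennreal (\<rho> / p) * (indicator (ball 0 P) (x - y) * ennreal ((?w x - ?w y)\<^sup>2)) \<le>
        ennreal (j (x - y) * (v x - v y) * (phi (p - 1) (v x) - phi (p - 1) (v y)))"
      using assms(1,2) by (auto simp: indicator_def ennreal_mult[symmetric] mult_ac split: if_splits)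
  qed simp
  finally show ?thesis .
qed

text \<open>
  Integrated and optimized in \<open>\<mu>\<close>, this interpolates the moment of order \<open>p / 2\<close> between those of
  orders \<open>1\<close> and \<open>p\<close>.
\<close>

lemma powr_half_le_split:
  fixes s \<mu> :: real
  assumes "2 \<le> p" "0 < \<mu>" "0 \<le> s"
  shows "s powr (p / 2) \<le> \<mu> powr (p / 2 - 1) * s + \<mu> powr (- p / 2) * s powr p"
proof (cases "s \<le> \<mu>")
  case True
  have "s powr (p / 2) = s powr (p / 2 - 1) * s"
    using assms powr_add[of s "p / 2 - 1" 1] by simp
  also have "\<dots> \<le> \<mu> powr (p / 2 - 1) * s"
    using assms True by (intro mult_right_mono powr_mono2) auto
  finally show ?thesis
    using add_increasing2[of "\<mu> powr (- p / 2) * s powr p"] by simp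
next
  case False
  have "s powr (p / 2) = s powr (- p / 2) * s powr p"
    by (simp add: powr_add[symmetric])
  also have "\<dots> \<le> \<mu> powr (- p / 2) * s powr p"
    using assms False by (intro mult_right_mono powr_mono2') auto
  finally show ?thesis
    using assms add_increasing[of "\<mu> powr (p / 2 - 1) * s"] by simp
qed

lemma exists_energy_inequality:
  fixes p \<gamma> :: real
  assumes p: "2 \<le> p" and \<gamma>: "\<gamma> = 2 / (real CARD('n::finite) * (p - 1))"
  shows "\<exists>C>0. energy_inequality TYPE('n) p \<gamma> C"
proof -
  define N where "N = CARD('n)"
  define \<omega> where "\<omega> = unit_ball_vol (real N)"
  define \<kappa> where "\<kappa> = 4 * (8 / \<omega>) powr (2 / real N)"
  define C where "C = \<omega> * min 1 (1 / \<kappa>) / 2"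
  have N: "0 < N"
    by (simp add: N_def)
  have \<omega>: "0 < \<omega>"
    by (simp add: \<omega>_def)
  then have \<kappa>: "0 < \<kappa>"
    by (simp add: \<kappa>_def)
  have "0 < \<gamma>"
    using p by (simp add: \<gamma>)
  have "0 < C"
    using \<omega> \<kappa> by (simp add: C_def)
  moreover have "energy_inequality TYPE('n) p \<gamma> C"
    unfolding energy_inequality_def
  proof (intro allI impI, elim conjE)
    fix j v :: "real^'n \<Rightarrow> real" and \<rho> P :: real
    assume j: "\<forall>z. 0 \<le> j z" "\<forall>z. norm z < P \<longrightarrow> \<rho> \<le> j z" and "0 < \<rho>" "0 < P" and "L1p_mem p v"
    define M where "M = Lq_pow 1 v"
    define F where "F = Lq_pow p v"
    have mem: "Lq_mem 1 v" "Lq_mem p v" "v \<in> borel_measurable lebesgue"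
      using \<open>L1p_mem p v\<close> by (auto simp: L1p_mem_def Lq_mem_def)
    have norms: "Lq_norm p v powr p = F" "Lq_norm p v powr (p * (1 + \<gamma>)) = F powr (1 + \<gamma>)"
      using Lq_norm_powr[of p v 1] Lq_norm_powr[of p v "1 + \<gamma>"] p by (simp_all add: F_def)
    show "ennreal (C * \<rho> *
          min (P ^ (CARD('n) + 2) * Lq_norm 1 v powr (- p * \<gamma>) * Lq_norm p v powr (p * (1 + \<gamma>)))
              (P ^ CARD('n) * Lq_norm p v powr p)) \<le> energy p j v"
    proof (cases "F = 0")
      case True
      then show ?thesis
        by (simp add: norms)
    next
      case False
      then have F: "0 < F"
        using Lq_pow_nonneg[of p v] unfolding F_def by linarith
      have "M \<noteq> 0"
        using False mem Lq_pow_eq_0_iff by (auto simp: M_def F_def)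
      then have M: "0 < M"
        using Lq_pow_nonneg[of 1 v] unfolding M_def by linarith
      obtain g where [measurable]: "g \<in> borel_measurable borel" and g: "AE x in lborel. v x = g x"
        using Lq_mem_borel_representative[OF mem(3)] .
      define w where "w x = phi (p / 2) (g x)" for x
      have [measurable]: "w \<in> borel_measurable borel"
        unfolding w_def by measurable
      have g1: "integrable lborel (\<lambda>x. \<bar>g x\<bar>)" "M = (LINT x|lborel. \<bar>g x\<bar>)"
        using Lq_mem_cong_AE[OF g mem(1)] by (simp_all add: M_def)
      have gp: "integrable lborel (\<lambda>x. \<bar>g x\<bar> powr p)" "F = (LINT x|lborel. \<bar>g x\<bar> powr p)"
        using Lq_mem_cong_AE[OF g mem(2)] by (simp_all add: F_def)
      have "(w x)\<^sup>2 = \<bar>g x\<bar> powr p" for x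
        using abs_phi[of "p / 2" "g x"]
        by (metis power2_abs power2_eq_square powr_add field_sum_of_halves w_def)
      then have S: "(\<integral>\<^sup>+x. ennreal ((w x)\<^sup>2) \<partial>lborel) = ennreal F"
        using gp by (simp add: nn_integral_eq_integral)
      \<comment> \<open>This \<open>\<mu>\<close> makes the two terms of \<open>W\<close> below equal.\<close>
      define \<mu> where "\<mu> = (F / M) powr (1 / (p - 1))"
      have \<mu>: "0 < \<mu>"
        using F M by (simp add: \<mu>_def)
      define W where "W = \<mu> powr (p / 2 - 1) * M + \<mu> powr (- p / 2) * F"
      have "0 < W"
        using \<mu> M F by (simp add: W_def add_pos_pos)
      have "(\<integral>\<^sup>+x. ennreal \<bar>w x\<bar> \<partial>lborel) \<le>
          (\<integral>\<^sup>+x. ennreal (\<mu> powr (p / 2 - 1) * \<bar>g x\<bar> + \<mu> powr (- p / 2) * \<bar>g x\<bar> powr p) \<partial>lborel)"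
        unfolding w_def abs_phi
        by (intro nn_integral_mono ennreal_leI powr_half_le_split[OF p \<mu>]) simp
      also have "\<dots> = ennreal W"
        using g1 gp by (subst nn_integral_eq_integral) (auto simp: W_def)
      finally have W: "(\<integral>\<^sup>+x. ennreal \<bar>w x\<bar> \<partial>lborel) \<le> ennreal W" .
      have lnW: "ln (2 * W\<^sup>2 / (\<omega> * F)) = ln (8 / \<omega>) + (p * ln M - ln F) / (p - 1)"
      proof -
        have ln\<mu>: "ln \<mu> = (ln F - ln M) / (p - 1)"
          using F M by (simp add: \<mu>_def ln_powr ln_div)
        have "ln (\<mu> powr (p / 2 - 1) * M) = ln (\<mu> powr (- p / 2) * F)"
          using \<mu> F M p by (simp add: ln_mult ln_powr ln\<mu> field_simps)
        then have "\<mu> powr (p / 2 - 1) * M = \<mu> powr (- p / 2) * F"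
          using \<mu> F M by simp
        then have "W = 2 * (\<mu> powr (- p / 2) * F)"
          by (simp add: W_def)
        then have "ln W = ln 2 - p / 2 * ln \<mu> + ln F"
          using \<mu> F by (simp add: ln_mult ln_powr)
        moreover have "ln (8::real) = 3 * ln 2"
          using ln_realpow[of "2::real" 3] by simp
        ultimately show ?thesis
          using \<open>0 < W\<close> \<omega> F p by (simp add: ln_mult ln_div ln_realpow ln\<mu> field_simps)
      qed
      have K: "P\<^sup>2 / (4 * (2 * W\<^sup>2 / (\<omega> * F)) powr (2 / real N)) = P\<^sup>2 * M powr (- p * \<gamma>) * F powr \<gamma> / \<kappa>"
      proof -
        define X where "X = 2 * W\<^sup>2 / (\<omega> * F)"
        have "0 < X"
          using \<open>0 < W\<close> \<omega> F by (simp add: X_def)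
        have "ln (X powr (2 / real N)) = 2 / real N * (ln (8 / \<omega>) + (p * ln M - ln F) / (p - 1))"
          using lnW \<open>0 < X\<close> by (simp add: ln_powr X_def)
        also have "\<dots> = 2 / real N * ln (8 / \<omega>) + \<gamma> * (p * ln M - ln F)"
          by (simp add: \<gamma> N_def distrib_left)
        also have "\<dots> = ln ((8 / \<omega>) powr (2 / real N) * (M powr (p * \<gamma>) / F powr \<gamma>))"
          using \<omega> F M by (simp add: ln_mult ln_div ln_powr right_diff_distrib)
        finally have X: "X powr (2 / real N) = (8 / \<omega>) powr (2 / real N) * (M powr (p * \<gamma>) / F powr \<gamma>)"
          using \<open>0 < X\<close> \<omega> F M by (subst (asm) ln_inj_iff) auto
        show ?thesis
          unfolding X_def[symmetric] \<kappa>_def X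
          using M F by (simp add: powr_minus divide_simps)
      qed
      define Y where "Y = P\<^sup>2 * M powr (- p * \<gamma>) * F powr \<gamma>"
      have "P ^ (N + 2) * M powr (- p * \<gamma>) * F powr (1 + \<gamma>) = P ^ N * F * Y"
        using F by (simp add: Y_def powr_add power_add power2_eq_square mult_ac)
      moreover have "min (P ^ N * F * Y) (P ^ N * F) = P ^ N * F * min Y 1"
        using F \<open>0 < P\<close> by (simp add: min_mult_distrib_left)
      ultimately have "C * \<rho> * min (P ^ (N + 2) * M powr (- p * \<gamma>) * F powr (1 + \<gamma>)) (P ^ N * F) =
          \<rho> / 2 * (\<omega> * P ^ N * F * (min 1 (1 / \<kappa>) * min Y 1))"
        by (simp only: C_def) (simp add: mult_ac)
      also have "\<dots> \<le> \<rho> / 2 * (\<omega> * P ^ N * F *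
          min 1 (P\<^sup>2 / (4 * (2 * W\<^sup>2 / (\<omega> * F)) powr (2 / real N))))"
      proof -
        have "min 1 (1 / \<kappa>) * min X 1 \<le> min 1 (X / \<kappa>)" if "0 \<le> X" for X
        proof -
          have "min 1 (1 / \<kappa>) * min X 1 \<le> 1 * 1"
            using that \<kappa> by (intro mult_mono) auto
          moreover have "min 1 (1 / \<kappa>) * min X 1 \<le> 1 / \<kappa> * X"
            using that \<kappa> by (intro mult_mono) auto
          ultimately show ?thesis by simp
        qed
        then show ?thesis
          unfolding K Y_def[symmetric] using \<open>0 < \<rho>\<close> \<omega> \<open>0 < P\<close> F by (intro mult_left_mono) (auto simp: Y_def)
      qed
      finally have "ennreal (C * \<rho> * min (P ^ (N + 2) * M powr (- p * \<gamma>) * F powr (1 + \<gamma>)) (P ^ N * F)) \<le>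
          ennreal (\<rho> / 2) * ennreal (\<omega> * P ^ N * F *
          min 1 (P\<^sup>2 / (4 * (2 * W\<^sup>2 / (\<omega> * F)) powr (2 / real N))))"
        using \<open>0 < \<rho>\<close> \<omega> \<open>0 < P\<close> F by (subst ennreal_mult[symmetric]) (auto intro!: ennreal_leI)
      also have "\<dots> \<le> ennreal (\<rho> / 2) * interaction w P"
        using interaction_Nash[of w F W P] S F W \<open>0 < W\<close> \<open>0 < P\<close>
        by (intro mult_left_mono) (auto simp: \<omega>_def N_def)
      also have "\<dots> \<le> energy p j g"
        unfolding w_def using j p \<open>0 < \<rho>\<close> by (intro energy_ge_interaction) auto
      also have "\<dots> = energy p j v"
        by (rule energy_cong_AE[OF g, symmetric])
      finally show ?thesis
        by (simp add: norms M_def N_def)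
    qed
  qed
  ultimately show ?thesis by blast
qed

section \<open>Comparison by left Dini derivatives\<close>

text \<open>
  If \<open>d b\<close> were positive, it would remain so after the subtraction of a small multiple of \<open>s - a\<close>; the
  leftmost point at which the resulting function is at least its value at \<open>b\<close> contradicts the bound on
  the Dini derivative.
\<close>

lemma left_Dini_nonpos:
  fixes d :: "real \<Rightarrow> real"
  assumes "a \<le> b" and cont: "continuous_on {a..b} d" and "d a \<le> 0"
    and dini: "\<And>s \<eta>. a < s \<Longrightarrow> s \<le> b \<Longrightarrow> 0 < d s \<Longrightarrow> 0 < \<eta> \<Longrightarrow>
      \<forall>\<^sub>F r in at_left s. d s - d r \<le> \<eta> * (s - r)"
  shows "d b \<le> 0"
proof (rule ccontr)
  assume "\<not> d b \<le> 0"
  then have "0 < d b" "a < b"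
    using \<open>d a \<le> 0\<close> \<open>a \<le> b\<close> by (auto simp: order.order_iff_strict)
  define \<eta> where "\<eta> = d b / (2 * (b - a))"
  have \<eta>: "0 < \<eta>"
    using \<open>0 < d b\<close> \<open>a < b\<close> by (simp add: \<eta>_def)
  define g where "g s = d s - \<eta> * (s - a)" for s
  have "g b = d b / 2"
    using \<open>a < b\<close> by (simp add: g_def \<eta>_def field_simps)
  then have "0 < g b"
    using \<open>0 < d b\<close> by simp
  have cont_g: "continuous_on {a..b} g"
    unfolding g_def by (intro continuous_intros cont)
  \<comment> \<open>The infimum of \<open>T\<close> belongs to \<open>T\<close>, but \<open>T\<close> has an element to its left.\<close>
  define T where "T = {s \<in> {a..b}. g b \<le> g s}"
  have "closed T"
    unfolding T_def by (intro continuous_on_closed_Collect_le continuous_intros cont_g)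
  moreover have "b \<in> T" "bdd_below T"
    using \<open>a \<le> b\<close> by (auto simp: T_def)
  ultimately have "Inf T \<in> T"
    by (intro closed_contains_Inf) auto
  define m where "m = Inf T"
  have m: "a \<le> m" "m \<le> b" "g b \<le> g m"
    using \<open>Inf T \<in> T\<close> by (auto simp: m_def T_def)
  have "a < m"
  proof (rule ccontr)
    assume "\<not> a < m"
    then have "m = a"
      using m by simp
    then show False
      using m \<open>0 < g b\<close> \<open>d a \<le> 0\<close> by (simp add: g_def)
  qed
  have "0 < d m"
  proof -
    have "g m \<le> d m"
      using m \<eta> by (simp add: g_def)
    then show ?thesis
      using m \<open>0 < g b\<close> by linarith
  qed
  have "\<forall>\<^sub>F r in at_left m. d m - d r \<le> \<eta> * (m - r)"
    by (rule dini) fact+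
  moreover have "\<forall>\<^sub>F r in at_left m. a < r \<and> r < m"
    using eventually_at_left_real[OF \<open>a < m\<close>] by eventually_elim auto
  ultimately have "\<forall>\<^sub>F r in at_left m. d m - d r \<le> \<eta> * (m - r) \<and> a < r \<and> r < m"
    by eventually_elim auto
  then obtain r where r: "d m - d r \<le> \<eta> * (m - r)" "a < r" "r < m"
    using eventually_happens'[OF trivial_limit_at_left_real] by blast
  then have "g m \<le> g r"
    by (simp add: g_def algebra_simps)
  then have "r \<in> T"
    using m r by (simp add: T_def)
  then have "m \<le> r"
    unfolding m_def using \<open>bdd_below T\<close> by (rule cInf_lower)
  then show False
    using r by simp
qed

lemma left_Dini_comparison:
  fixes f y y' :: "real \<Rightarrow> real"
  assumes "a \<le> b" and f: "continuous_on {a..b} f" and y: "continuous_on {a..b} y"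
    and y': "\<And>s. a < s \<Longrightarrow> s \<le> b \<Longrightarrow> (y has_real_derivative y' s) (at s)"
    and "f a \<le> y a"
    and dini: "\<And>s \<eta>. a < s \<Longrightarrow> s \<le> b \<Longrightarrow> y s < f s \<Longrightarrow> 0 < \<eta> \<Longrightarrow>
      \<forall>\<^sub>F r in at_left s. f s - f r \<le> (y' s + \<eta>) * (s - r)"
  shows "f b \<le> y b"
proof -
  have "f b - y b \<le> 0"
  proof (rule left_Dini_nonpos[OF \<open>a \<le> b\<close>])
    show "continuous_on {a..b} (\<lambda>s. f s - y s)"
      by (intro continuous_intros f y)
    show "f a - y a \<le> 0"
      using \<open>f a \<le> y a\<close> by simp
    fix s \<eta> :: real
    assume s: "a < s" "s \<le> b" "0 < f s - y s" and "0 < \<eta>"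
    have "((\<lambda>r. (y r - y s) / (r - s)) \<longlongrightarrow> y' s) (at s)"
      using y'[OF s(1,2)] by (simp add: has_field_derivative_iff)
    then have "((\<lambda>r. (y r - y s) / (r - s)) \<longlongrightarrow> y' s) (at_left s)"
      by (rule tendsto_within_subset) simp
    then have "\<forall>\<^sub>F r in at_left s. y' s - \<eta> / 2 < (y r - y s) / (r - s)"
      using \<open>0 < \<eta>\<close> by (intro order_tendstoD) auto
    moreover have "\<forall>\<^sub>F r in at_left s. f s - f r \<le> (y' s + \<eta> / 2) * (s - r)"
      using s \<open>0 < \<eta>\<close> by (intro dini) auto
    moreover have "\<forall>\<^sub>F r in at_left s. r < s"
      by (simp add: eventually_at_filter)
    ultimately show "\<forall>\<^sub>F r in at_left s. f s - y s - (f r - y r) \<le> \<eta> * (s - r)"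
    proof eventually_elim
      case (elim r)
      then have "(y' s - \<eta> / 2) * (s - r) \<le> (y r - y s) / (r - s) * (s - r)"
        by (intro mult_right_mono) auto
      also have "\<dots> = y s - y r"
        using elim by (simp add: field_simps)
      finally have "(y' s - \<eta> / 2) * (s - r) \<le> y s - y r" .
      moreover have "(y' s + \<eta> / 2) * (s - r) = (y' s - \<eta> / 2) * (s - r) + \<eta> * (s - r)"
        by (simp add: field_simps)
      ultimately show ?case
        using elim by linarith
    qed
  qed
  then show ?thesis by simp
qed

section \<open>Norms along differentiable curves in \<open>L\<^sup>q\<close>\<close>

text \<open>The tangent line inequality for the convex function \<open>s \<mapsto> \<bar>s\<bar> powr q\<close>, which holds also for \<open>q = 1\<close>.\<close>

lemma powr_ge_tangent:
  assumes "1 \<le> q"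
  shows "\<bar>a\<bar> powr q + q * (phi (q - 1) a * (b - a)) \<le> \<bar>b\<bar> powr q"
proof -
  have "q * (phi (q - 1) a * b) \<le> (q - 1) * \<bar>a\<bar> powr q + \<bar>b\<bar> powr q"
  proof (cases "a = 0 \<or> b = 0")
    case True
    then show ?thesis
      using assms by auto
  next
    case False
    have "phi (q - 1) a * b \<le> \<bar>a\<bar> powr (q - 1) * \<bar>b\<bar>"
      using abs_ge_self[of "phi (q - 1) a * b"] by (simp add: abs_mult abs_phi)
    also have "\<dots> = (\<bar>a\<bar> powr q) powr ((q - 1) / q) * (\<bar>b\<bar> powr q) powr (1 / q)"
      using assms by (simp add: powr_powr)
    also have "\<dots> \<le> (q - 1) / q * \<bar>a\<bar> powr q + 1 / q * \<bar>b\<bar> powr q"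
      using assms False by (intro Youngs_inequality_0) (auto simp: field_simps)
    finally have "q * (phi (q - 1) a * b) \<le> q * ((q - 1) / q * \<bar>a\<bar> powr q + 1 / q * \<bar>b\<bar> powr q)"
      using assms by (intro mult_left_mono) auto
    also have "\<dots> = (q - 1) * \<bar>a\<bar> powr q + \<bar>b\<bar> powr q"
      using assms by (simp add: field_simps)
    finally show ?thesis .
  qed
  moreover have "q * (phi (q - 1) a * (b - a)) = q * (phi (q - 1) a * b) - q * \<bar>a\<bar> powr q"
    by (simp add: right_diff_distrib phi_mult_self)
  ultimately show ?thesis
    by (simp add: left_diff_distrib)
qed

text \<open>
  A weak form of Young's inequality; it takes the place of Hoelder's inequality and includes \<open>q = 1\<close>.
\<close>

lemma abs_phi_mult_le:
  assumes "1 \<le> q" "0 < \<delta>"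
  shows "\<bar>phi (q - 1) a * e\<bar> \<le> \<delta> * \<bar>a\<bar> powr q + \<delta> powr (1 - q) * \<bar>e\<bar> powr q"
proof -
  have powr_q: "\<bar>s\<bar> powr q = \<bar>s\<bar> powr (q - 1) * \<bar>s\<bar>" for s :: real
    using powr_add[of "\<bar>s\<bar>" "q - 1" 1] by simp
  show ?thesis
  proof (cases "\<bar>e\<bar> \<le> \<delta> * \<bar>a\<bar>")
    case True
    then have "\<bar>a\<bar> powr (q - 1) * \<bar>e\<bar> \<le> \<bar>a\<bar> powr (q - 1) * (\<delta> * \<bar>a\<bar>)"
      by (intro mult_left_mono) auto
    also have "\<dots> = \<delta> * \<bar>a\<bar> powr q"
      by (simp add: powr_q)
    also have "\<dots> \<le> \<delta> * \<bar>a\<bar> powr q + \<delta> powr (1 - q) * \<bar>e\<bar> powr q"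
      by simp
    finally show ?thesis
      by (simp add: abs_mult abs_phi)
  next
    case False
    then have "\<bar>a\<bar> \<le> \<bar>e\<bar> / \<delta>"
      using assms by (simp add: field_simps)
    then have "\<bar>a\<bar> powr (q - 1) \<le> (\<bar>e\<bar> / \<delta>) powr (q - 1)"
      using assms by (intro powr_mono2) auto
    also have "\<dots> = \<delta> powr (1 - q) * \<bar>e\<bar> powr (q - 1)"
      using assms powr_minus[of \<delta> "q - 1"] by (simp add: powr_divide field_simps)
    finally have "\<bar>a\<bar> powr (q - 1) * \<bar>e\<bar> \<le> \<delta> powr (1 - q) * \<bar>e\<bar> powr (q - 1) * \<bar>e\<bar>"
      by (intro mult_right_mono) auto
    also have "\<dots> = \<delta> powr (1 - q) * \<bar>e\<bar> powr q"
      by (simp add: powr_q)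
    also have "\<dots> \<le> \<delta> * \<bar>a\<bar> powr q + \<delta> powr (1 - q) * \<bar>e\<bar> powr q"
      using assms by simp
    finally show ?thesis
      by (simp add: abs_mult abs_phi)
  qed
qed

lemma powr_abs_add_le:
  fixes a b :: real
  assumes "0 \<le> q"
  shows "\<bar>a + b\<bar> powr q \<le> 2 powr q * (\<bar>a\<bar> powr q + \<bar>b\<bar> powr q)"
proof -
  have "\<bar>a + b\<bar> powr q \<le> (2 * max \<bar>a\<bar> \<bar>b\<bar>) powr q"
    using assms by (intro powr_mono2) auto
  also have "\<dots> = 2 powr q * max \<bar>a\<bar> \<bar>b\<bar> powr q"
    by (simp add: powr_mult)
  also have "\<dots> \<le> 2 powr q * (\<bar>a\<bar> powr q + \<bar>b\<bar> powr q)"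
    by (intro mult_left_mono) (auto simp: max_def)
  finally show ?thesis .
qed

lemma Lq_mem_measurable: "Lq_mem q f \<Longrightarrow> f \<in> borel_measurable lebesgue"
  by (simp add: Lq_mem_def)

lemma Lq_mem_integrable: "Lq_mem q f \<Longrightarrow> integrable lebesgue (\<lambda>x. \<bar>f x\<bar> powr q)"
  by (simp add: Lq_mem_def)

lemma Lq_mem_add:
  fixes f h :: "real^'n \<Rightarrow> real"
  assumes "0 \<le> q" "Lq_mem q f" "Lq_mem q h"
  shows "Lq_mem q (\<lambda>x. f x + h x)"
    and "Lq_pow q (\<lambda>x. f x + h x) \<le> 2 powr q * (Lq_pow q f + Lq_pow q h)"
proof -
  note [measurable] = Lq_mem_measurable[OF assms(2)] Lq_mem_measurable[OF assms(3)]
  note int = Lq_mem_integrable[OF assms(2)] Lq_mem_integrable[OF assms(3)]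
  have int_bound: "integrable lebesgue (\<lambda>x. 2 powr q * (\<bar>f x\<bar> powr q + \<bar>h x\<bar> powr q))"
    using int by auto
  then have int_sum: "integrable lebesgue (\<lambda>x. \<bar>f x + h x\<bar> powr q)"
    by (rule Bochner_Integration.integrable_bound) (auto intro!: AE_I2 powr_abs_add_le[OF assms(1)])
  then show "Lq_mem q (\<lambda>x. f x + h x)"
    by (simp add: Lq_mem_def)
  have "Lq_pow q (\<lambda>x. f x + h x) \<le> (LINT x|lebesgue. 2 powr q * (\<bar>f x\<bar> powr q + \<bar>h x\<bar> powr q))"
    unfolding Lq_pow_def by (intro integral_mono int_sum int_bound powr_abs_add_le assms(1))
  also have "\<dots> = 2 powr q * (Lq_pow q f + Lq_pow q h)"
    using int by (simp add: Lq_pow_def)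
  finally show "Lq_pow q (\<lambda>x. f x + h x) \<le> 2 powr q * (Lq_pow q f + Lq_pow q h)" .
qed

lemma Lq_mem_cmult:
  fixes f :: "real^'n \<Rightarrow> real"
  assumes "Lq_mem q f"
  shows "Lq_mem q (\<lambda>x. c * f x)" and "Lq_pow q (\<lambda>x. c * f x) = \<bar>c\<bar> powr q * Lq_pow q f"
  using assms by (auto simp: Lq_mem_def Lq_pow_def abs_mult powr_mult)

lemma Lq_mem_diff:
  fixes f h :: "real^'n \<Rightarrow> real"
  assumes "0 \<le> q" "Lq_mem q f" "Lq_mem q h"
  shows "Lq_mem q (\<lambda>x. f x - h x)"
  using Lq_mem_add(1)[OF assms(1,2) Lq_mem_cmult(1)[OF assms(3), of "- 1"]] by simp

lemma integrable_phi_mult: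
  fixes f h :: "real^'n \<Rightarrow> real"
  assumes "1 \<le> q" "Lq_mem q f" "Lq_mem q h"
  shows "integrable lebesgue (\<lambda>x. phi (q - 1) (f x) * h x)"
    and "0 < \<delta> \<Longrightarrow> \<bar>LINT x|lebesgue. phi (q - 1) (f x) * h x\<bar> \<le>
      \<delta> * Lq_pow q f + \<delta> powr (1 - q) * Lq_pow q h"
proof -
  note [measurable] = Lq_mem_measurable[OF assms(2)] Lq_mem_measurable[OF assms(3)]
  note int = Lq_mem_integrable[OF assms(2)] Lq_mem_integrable[OF assms(3)]
  have bound: "integrable lebesgue (\<lambda>x. \<delta> * \<bar>f x\<bar> powr q + \<delta> powr (1 - q) * \<bar>h x\<bar> powr q)" for \<delta>
    using int by auto
  show int_phi: "integrable lebesgue (\<lambda>x. phi (q - 1) (f x) * h x)"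
    using bound[of 1]
    by (rule Bochner_Integration.integrable_bound)
      (auto intro!: AE_I2 order_trans[OF abs_phi_mult_le[OF assms(1), of 1]])
  assume "0 < \<delta>"
  have "\<bar>LINT x|lebesgue. phi (q - 1) (f x) * h x\<bar> \<le> (LINT x|lebesgue. \<bar>phi (q - 1) (f x) * h x\<bar>)"
    by (rule integral_abs_bound)
  also have "\<dots> \<le> (LINT x|lebesgue. \<delta> * \<bar>f x\<bar> powr q + \<delta> powr (1 - q) * \<bar>h x\<bar> powr q)"
    using \<open>0 < \<delta>\<close> by (intro integral_mono integrable_abs int_phi bound abs_phi_mult_le assms(1))
  also have "\<dots> = \<delta> * Lq_pow q f + \<delta> powr (1 - q) * Lq_pow q h"
    using int by (simp add: Lq_pow_def)
  finally show "\<bar>LINT x|lebesgue. phi (q - 1) (f x) * h x\<bar> \<le>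
      \<delta> * Lq_pow q f + \<delta> powr (1 - q) * Lq_pow q h" .
qed

lemma Lq_pow_diff_le:
  fixes f h :: "real^'n \<Rightarrow> real"
  assumes "1 \<le> q" "Lq_mem q f" "Lq_mem q h"
  shows "Lq_pow q f - Lq_pow q h \<le> q * (LINT x|lebesgue. phi (q - 1) (f x) * (f x - h x))"
proof -
  note int = Lq_mem_integrable[OF assms(2)] Lq_mem_integrable[OF assms(3)]
  have "Lq_mem q (\<lambda>x. f x - h x)"
    using assms by (intro Lq_mem_diff) auto
  note int_phi = integrable_phi_mult(1)[OF assms(1,2) this]
  have "Lq_pow q f - Lq_pow q h = (LINT x|lebesgue. \<bar>f x\<bar> powr q - \<bar>h x\<bar> powr q)"
    using int by (simp add: Lq_pow_def)
  also have "\<dots> \<le> (LINT x|lebesgue. q * (phi (q - 1) (f x) * (f x - h x)))"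
  proof (intro integral_mono)
    fix x
    show "\<bar>f x\<bar> powr q - \<bar>h x\<bar> powr q \<le> q * (phi (q - 1) (f x) * (f x - h x))"
      using powr_ge_tangent[OF assms(1), of "f x" "h x"] by (simp add: algebra_simps)
  qed (use int int_phi in auto)
  also have "\<dots> = q * (LINT x|lebesgue. phi (q - 1) (f x) * (f x - h x))"
    by simp
  finally show ?thesis .
qed

lemma abs_Lq_pow_diff_le:
  fixes f h :: "real^'n \<Rightarrow> real"
  assumes "1 \<le> q" "Lq_mem q f" "Lq_mem q h" "0 < \<delta>" and B: "Lq_pow q f \<le> B" "Lq_pow q h \<le> B"
  shows "\<bar>Lq_pow q f - Lq_pow q h\<bar> \<le> q * (\<delta> * B + \<delta> powr (1 - q) * Lq_pow q (\<lambda>x. f x - h x))"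
proof -
  have le: "Lq_pow q f - Lq_pow q h \<le> q * (\<delta> * B + \<delta> powr (1 - q) * Lq_pow q (\<lambda>x. f x - h x))"
    if f: "Lq_mem q f" and h: "Lq_mem q h" and B: "Lq_pow q f \<le> B" for f h :: "real^'n \<Rightarrow> real"
  proof -
    have d: "Lq_mem q (\<lambda>x. f x - h x)"
      using f h assms(1) by (intro Lq_mem_diff) auto
    have "(LINT x|lebesgue. phi (q - 1) (f x) * (f x - h x)) \<le>
        \<delta> * Lq_pow q f + \<delta> powr (1 - q) * Lq_pow q (\<lambda>x. f x - h x)"
      using integrable_phi_mult(2)[OF assms(1) f d \<open>0 < \<delta>\<close>] by linarith
    also have "\<dots> \<le> \<delta> * B + \<delta> powr (1 - q) * Lq_pow q (\<lambda>x. f x - h x)"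
      using B \<open>0 < \<delta>\<close> by (intro add_right_mono mult_left_mono) auto
    finally show ?thesis
      using Lq_pow_diff_le[OF assms(1) f h] assms(1)
      by (meson mult_left_mono order_trans zero_le_one)
  qed
  have "Lq_pow q (\<lambda>x. h x - f x) = Lq_pow q (\<lambda>x. f x - h x)"
    by (simp add: Lq_pow_def abs_minus_commute)
  then show ?thesis
    using le[OF assms(2,3) B(1)] le[OF assms(3,2) B(2)] by (simp add: abs_le_iff)
qed

text \<open>
  \<open>Lq_diff q u u' t\<close>: the curve \<open>u\<close> in \<open>L\<^sup>q\<close> has the derivative \<open>u'\<close> at time \<open>t\<close>, one-sided if
  \<open>t = 0\<close>. Membership of all the values in \<open>L\<^sup>q\<close> is part of the notion.
\<close>

definition Lq_diff :: "real \<Rightarrow> (real \<Rightarrow> real^'n \<Rightarrow> real) \<Rightarrow> (real^'n \<Rightarrow> real) \<Rightarrow> real \<Rightarrow> bool" where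
  "Lq_diff q u u' t \<longleftrightarrow> (\<forall>s\<ge>0. Lq_mem q (u s)) \<and> Lq_mem q u' \<and>
     ((\<lambda>s. Lq_pow q (\<lambda>x. (u s x - u t x) / (s - t) - u' x)) \<longlongrightarrow> 0) (at t within {0..})"

lemma Lq_diff_quotient_mem:
  assumes "0 \<le> q" "Lq_diff q u u' t" "0 \<le> t" "0 \<le> s"
  shows "Lq_mem q (\<lambda>x. (u s x - u t x) / (s - t) - u' x)"
proof -
  have "Lq_mem q (\<lambda>x. u s x - u t x)"
    using assms by (intro Lq_mem_diff) (auto simp: Lq_diff_def)
  from Lq_mem_cmult(1)[OF this, of "1 / (s - t)"] show ?thesis
    using assms by (intro Lq_mem_diff) (auto simp: Lq_diff_def)
qed

lemma Lq_diff_imp_tendsto: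
  assumes "1 \<le> q" "Lq_diff q u u' t" "0 \<le> t"
  shows "((\<lambda>s. Lq_pow q (u s)) \<longlongrightarrow> Lq_pow q (u t)) (at t within {0..})"
proof -
  define e where "e = (\<lambda>s x. (u s x - u t x) / (s - t) - u' x)"
  define E where "E s = Lq_pow q (\<lambda>x. u s x - u t x)" for s
  have mem: "Lq_mem q (u s)" "Lq_mem q (e s)" "Lq_mem q u'" if "0 \<le> s" for s
    using assms that Lq_diff_quotient_mem[of q u u' t s] by (auto simp: Lq_diff_def e_def)
  have nonneg: "\<forall>\<^sub>F s in at t within {0..}. 0 \<le> s \<and> s \<noteq> t"
    by (auto simp: eventually_at_filter)
  have e0: "((\<lambda>s. Lq_pow q (e s)) \<longlongrightarrow> 0) (at t within {0..})"
    using assms by (simp add: Lq_diff_def e_def)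
  have E0: "(E \<longlongrightarrow> 0) (at t within {0..})"
  proof (rule tendsto_sandwich)
    show "\<forall>\<^sub>F s in at t within {0..}. 0 \<le> E s"
      by (simp add: E_def)
    show "\<forall>\<^sub>F s in at t within {0..}.
        E s \<le> \<bar>s - t\<bar> powr q * (2 powr q * (Lq_pow q (e s) + Lq_pow q u'))"
      using nonneg
    proof eventually_elim
      case (elim s)
      have "E s = Lq_pow q (\<lambda>x. (s - t) * (e s x + u' x))"
        using elim by (simp add: E_def e_def)
      also have "\<dots> = \<bar>s - t\<bar> powr q * Lq_pow q (\<lambda>x. e s x + u' x)"
        using assms(1) mem elim by (intro Lq_mem_cmult(2) Lq_mem_add(1)) auto
      also have "\<dots> \<le> \<bar>s - t\<bar> powr q * (2 powr q * (Lq_pow q (e s) + Lq_pow q u'))"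
        using assms(1) mem elim by (intro mult_left_mono Lq_mem_add(2)) auto
      finally show ?case .
    qed
    have "((\<lambda>s. \<bar>s - t\<bar> powr q * (2 powr q * (Lq_pow q (e s) + Lq_pow q u')))
        \<longlongrightarrow> 0 * (2 powr q * (0 + Lq_pow q u'))) (at t within {0..})"
    proof (intro tendsto_mult tendsto_add tendsto_const e0)
      have "((\<lambda>s. \<bar>s - t\<bar>) \<longlongrightarrow> \<bar>t - t\<bar>) (at t within {0..})"
        by (intro tendsto_intros)
      then show "((\<lambda>s. \<bar>s - t\<bar> powr q) \<longlongrightarrow> 0) (at t within {0..})"
        using assms(1) by (intro tendsto_zero_powrI[where b = q]) auto
    qed
    then show "((\<lambda>s. \<bar>s - t\<bar> powr q * (2 powr q * (Lq_pow q (e s) + Lq_pow q u'))) \<longlongrightarrow> 0)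
        (at t within {0..})"
      by simp
  qed simp
  define B where "B = 2 powr q * (1 + Lq_pow q (u t))"
  have "0 < B"
    unfolding B_def by (intro mult_pos_pos add_pos_nonneg) auto
  have "Lq_pow q (u t) \<le> B"
  proof -
    have "1 * Lq_pow q (u t) \<le> B"
      unfolding B_def using assms(1) by (intro mult_mono) (auto simp: ge_one_powr_ge_zero)
    then show ?thesis by simp
  qed
  show ?thesis
    unfolding tendsto_iff
  proof (intro allI impI)
    fix \<eta> :: real
    assume "0 < \<eta>"
    define \<delta> where "\<delta> = \<eta> / (2 * q * B)"
    have "0 < \<delta>"
      using assms(1) \<open>0 < \<eta>\<close> \<open>0 < B\<close> by (simp add: \<delta>_def)
    have "((\<lambda>s. q * \<delta> powr (1 - q) * E s) \<longlongrightarrow> q * \<delta> powr (1 - q) * 0) (at t within {0..})"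
      by (intro tendsto_intros E0)
    then have "\<forall>\<^sub>F s in at t within {0..}. q * \<delta> powr (1 - q) * E s < \<eta> / 2"
      using \<open>0 < \<eta>\<close> by (intro order_tendstoD) auto
    moreover have "\<forall>\<^sub>F s in at t within {0..}. E s < 1"
      using E0 by (intro order_tendstoD) auto
    ultimately show "\<forall>\<^sub>F s in at t within {0..}. dist (Lq_pow q (u s)) (Lq_pow q (u t)) < \<eta>"
      using nonneg
    proof eventually_elim
      case (elim s)
      have "Lq_pow q (u s) = Lq_pow q (\<lambda>x. (u s x - u t x) + u t x)"
        by simp
      also have "\<dots> \<le> 2 powr q * (E s + Lq_pow q (u t))"
        unfolding E_def using assms mem elim by (intro Lq_mem_add(2) Lq_mem_diff) auto
      also have "\<dots> \<le> B"
        unfolding B_def using elim by (intro mult_left_mono) auto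
      finally have "Lq_pow q (u s) \<le> B" .
      then have "\<bar>Lq_pow q (u s) - Lq_pow q (u t)\<bar> \<le> q * (\<delta> * B + \<delta> powr (1 - q) * E s)"
        unfolding E_def using assms mem elim \<open>0 < \<delta>\<close> \<open>Lq_pow q (u t) \<le> B\<close>
        by (intro abs_Lq_pow_diff_le) auto
      also have "\<dots> = \<eta> / 2 + q * \<delta> powr (1 - q) * E s"
        using assms(1) \<open>0 < B\<close> by (simp add: \<delta>_def field_simps)
      also have "\<dots> < \<eta>"
        using elim by simp
      finally show ?case
        by (simp add: dist_real_def)
    qed
  qed
qed

text \<open>
  The left Dini derivative of the \<open>q\<close>-th power of the norm along a differentiable curve is bounded by
  the value that the chain rule suggests. Only backward difference quotients are used: for them the
  tangent line inequality at the fixed time \<open>t\<close> gives the bound without any continuity of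
  \<open>phi (q - 1)\<close> as a map on \<open>L\<^sup>q\<close>.
\<close>

lemma Lq_pow_left_Dini:
  assumes "1 \<le> q" "Lq_diff q u u' t" "0 < t"
    and D: "q * (LINT x|lebesgue. phi (q - 1) (u t x) * u' x) \<le> D" and "0 < \<eta>"
  shows "\<forall>\<^sub>F s in at_left t. Lq_pow q (u t) - Lq_pow q (u s) \<le> (D + \<eta>) * (t - s)"
proof -
  define e where "e = (\<lambda>s x. (u s x - u t x) / (s - t) - u' x)"
  have mem: "Lq_mem q (u s)" "Lq_mem q (e s)" "Lq_mem q u'" if "0 \<le> s" for s
    using assms that Lq_diff_quotient_mem[of q u u' t s] by (auto simp: Lq_diff_def e_def)
  have mem_t: "Lq_mem q (u t)"
    using mem \<open>0 < t\<close> by simp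
  have "((\<lambda>s. Lq_pow q (e s)) \<longlongrightarrow> 0) (at t within {0..})"
    using assms by (simp add: Lq_diff_def e_def)
  moreover have "at t within {0..} = at t"
    using \<open>0 < t\<close> by (intro at_within_interior) (simp add: interior_real_atLeast)
  ultimately have "((\<lambda>s. Lq_pow q (e s)) \<longlongrightarrow> 0) (at t)"
    by simp
  then have e0: "((\<lambda>s. Lq_pow q (e s)) \<longlongrightarrow> 0) (at_left t)"
    by (rule tendsto_within_subset) simp
  define \<delta> where "\<delta> = \<eta> / (2 * q * (1 + Lq_pow q (u t)))"
  have "0 < 1 + Lq_pow q (u t)"
    by (intro add_pos_nonneg) auto
  then have "0 < \<delta>"
    using assms(1) \<open>0 < \<eta>\<close> by (simp add: \<delta>_def)
  have "q * (\<delta> * Lq_pow q (u t)) \<le> q * (\<delta> * (1 + Lq_pow q (u t)))"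
    using assms(1) \<open>0 < \<delta>\<close> by (intro mult_left_mono) auto
  also have "\<dots> = \<eta> / 2"
    using assms(1) \<open>0 < 1 + Lq_pow q (u t)\<close> by (simp add: \<delta>_def)
  finally have \<delta>: "q * (\<delta> * Lq_pow q (u t)) \<le> \<eta> / 2" .
  have "((\<lambda>s. q * (\<delta> powr (1 - q) * Lq_pow q (e s))) \<longlongrightarrow> q * (\<delta> powr (1 - q) * 0)) (at_left t)"
    by (intro tendsto_intros e0)
  then have "\<forall>\<^sub>F s in at_left t. q * (\<delta> powr (1 - q) * Lq_pow q (e s)) < \<eta> / 2"
    using \<open>0 < \<eta>\<close> by (intro order_tendstoD) auto
  moreover have "\<forall>\<^sub>F s in at_left t. 0 < s \<and> s < t"
    using eventually_at_left_real[OF \<open>0 < t\<close>] by eventually_elim auto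
  ultimately show ?thesis
  proof eventually_elim
    case (elim s)
    have s: "0 \<le> s" "s < t"
      using elim by auto
    have int: "integrable lebesgue (\<lambda>x. phi (q - 1) (u t x) * u' x)"
      "integrable lebesgue (\<lambda>x. phi (q - 1) (u t x) * e s x)"
      using assms(1) mem s \<open>0 < t\<close> by (auto intro!: integrable_phi_mult(1))
    have u_diff: "u t x - u s x = (t - s) * (u' x + e s x)" for x
      using s by (simp add: e_def field_simps)
    have "(LINT x|lebesgue. phi (q - 1) (u t x) * (u t x - u s x)) =
        (LINT x|lebesgue. (t - s) * (phi (q - 1) (u t x) * u' x + phi (q - 1) (u t x) * e s x))"
      unfolding u_diff by (simp add: distrib_left mult.left_commute)
    also have "\<dots> = (t - s) * ((LINT x|lebesgue. phi (q - 1) (u t x) * u' x) +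
        (LINT x|lebesgue. phi (q - 1) (u t x) * e s x))"
      using int by simp
    finally have eq: "(LINT x|lebesgue. phi (q - 1) (u t x) * (u t x - u s x)) = \<dots>" .
    have "(LINT x|lebesgue. phi (q - 1) (u t x) * e s x) \<le>
        \<delta> * Lq_pow q (u t) + \<delta> powr (1 - q) * Lq_pow q (e s)"
      using integrable_phi_mult(2)[OF assms(1) mem_t mem(2)[OF s(1)] \<open>0 < \<delta>\<close>] by linarith
    then have "q * (LINT x|lebesgue. phi (q - 1) (u t x) * e s x) \<le>
        q * (\<delta> * Lq_pow q (u t) + \<delta> powr (1 - q) * Lq_pow q (e s))"
      using assms(1) by (intro mult_left_mono) auto
    also have "\<dots> \<le> \<eta>"
      using \<delta> elim by (simp add: distrib_left)
    finally have rem: "q * (LINT x|lebesgue. phi (q - 1) (u t x) * e s x) \<le> \<eta>" .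
    have "Lq_pow q (u t) - Lq_pow q (u s) \<le> q * (LINT x|lebesgue. phi (q - 1) (u t x) * (u t x - u s x))"
      using assms(1) mem s \<open>0 < t\<close> by (intro Lq_pow_diff_le) auto
    also have "\<dots> = (q * (LINT x|lebesgue. phi (q - 1) (u t x) * u' x) +
        q * (LINT x|lebesgue. phi (q - 1) (u t x) * e s x)) * (t - s)"
      unfolding eq by (simp add: distrib_left mult_ac)
    also have "\<dots> \<le> (D + \<eta>) * (t - s)"
      using D rem s by (intro mult_right_mono add_mono) auto
    finally show ?case .
  qed
qed

section \<open>Dissipation of the norms\<close>

lemma integrable_kernel_product:
  fixes K h :: "real^'n \<Rightarrow> real"
  assumes [measurable]: "K \<in> borel_measurable borel" "h \<in> borel_measurable borel"
    and K: "integrable lborel K" "\<And>z. K (- z) = K z" and h: "integrable lborel h"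
  shows "integrable (lborel \<Otimes>\<^sub>M lborel) (\<lambda>(x, y). K (x - y) * h x)"
    and "integrable (lborel \<Otimes>\<^sub>M lborel) (\<lambda>(x, y). K (x - y) * h y)"
proof -
  have shift: "(\<integral>\<^sup>+y. ennreal \<bar>K (x - y)\<bar> \<partial>lborel) = (\<integral>\<^sup>+z. ennreal \<bar>K z\<bar> \<partial>lborel)" for x
  proof -
    have "(\<integral>\<^sup>+y. ennreal \<bar>K (x - y)\<bar> \<partial>lborel) = (\<integral>\<^sup>+y. ennreal \<bar>K (- x + y)\<bar> \<partial>lborel)"
      using K(2)[of "x - y" for y] by simp
    also have "\<dots> = (\<integral>\<^sup>+z. ennreal \<bar>K z\<bar> \<partial>lborel)"
      by (rule nn_integral_lborel_translate) simp
    finally show ?thesis .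
  qed
  show int: "integrable (lborel \<Otimes>\<^sub>M lborel) (\<lambda>(x, y). K (x - y) * h x)"
  proof (rule integrableI_bounded)
    have "(\<integral>\<^sup>+z. ennreal (norm (case z of (x, y) \<Rightarrow> K (x - y) * h x)) \<partial>(lborel \<Otimes>\<^sub>M lborel)) =
        (\<integral>\<^sup>+x. (\<integral>\<^sup>+y. ennreal \<bar>h x\<bar> * ennreal \<bar>K (x - y)\<bar> \<partial>lborel) \<partial>lborel)"
      by (subst lborel.nn_integral_fst[symmetric]) (simp_all add: abs_mult ennreal_mult mult.commute)
    also have "\<dots> = (\<integral>\<^sup>+x. ennreal \<bar>h x\<bar> \<partial>lborel) * (\<integral>\<^sup>+z. ennreal \<bar>K z\<bar> \<partial>lborel)"
      by (simp add: nn_integral_cmult nn_integral_multc shift)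
    also have "\<dots> < \<infinity>"
      using K(1) h by (simp add: integrable_iff_bounded ennreal_mult_less_top)
    finally show "(\<integral>\<^sup>+z. ennreal (norm (case z of (x, y) \<Rightarrow> K (x - y) * h x)) \<partial>(lborel \<Otimes>\<^sub>M lborel)) < \<infinity>" .
  qed simp
  have "(\<lambda>(x, y). (case (y, x) of (x, y) \<Rightarrow> K (x - y) * h x)) = (\<lambda>(x, y). K (x - y) * h y)"
    using K(2) by (auto simp: fun_eq_iff) (metis minus_diff_eq)
  with lborel_pair.integrable_product_swap[OF int]
  show "integrable (lborel \<Otimes>\<^sub>M lborel) (\<lambda>(x, y). K (x - y) * h y)"
    by simp
qed

text \<open>
  The energy is what is dissipated: symmetrizing the double integral of
  \<open>phi (q - 1) (v x) * K (x - y) * (v y - v x)\<close> in \<open>x\<close> and \<open>y\<close> gives \<open>- energy q K v / q\<close>.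
\<close>

lemma dissipation_identity:
  fixes K v g :: "real^'n \<Rightarrow> real"
  assumes "1 \<le> q" and [measurable]: "K \<in> borel_measurable borel"
    and K: "integrable lborel K" "\<And>z. K (- z) = K z" "\<And>z. 0 \<le> K z"
    and v: "Lq_mem q v" and g: "g \<in> borel_measurable lebesgue"
    and eq: "AE x in lebesgue. g x = (LINT y|lebesgue. K (x - y) * (v y - v x))"
  shows "q * (LINT x|lebesgue. phi (q - 1) (v x) * g x) \<le> 0"
    and "energy q K v = ennreal (- (q * (LINT x|lebesgue. phi (q - 1) (v x) * g x)))"
proof -
  note vm = Lq_mem_measurable[OF v]
  obtain b where [measurable]: "b \<in> borel_measurable borel" and vb: "AE x in lborel. v x = b x"
    using Lq_mem_borel_representative[OF vm] .
  have vb': "AE x in lebesgue. v x = b x"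
    using vb by (rule AE_completion)
  have bm: "b \<in> borel_measurable lebesgue"
    by (rule measurable_completion) simp
  have b: "integrable lborel (\<lambda>x. \<bar>b x\<bar> powr q)"
    using Lq_mem_cong_AE[OF vb v] by simp
  define g0 where "g0 x = (LINT y|lborel. K (x - y) * (b y - b x))" for x
  have [measurable]: "g0 \<in> borel_measurable borel"
    unfolding g0_def by measurable
  have g0m: "g0 \<in> borel_measurable lebesgue"
    by (rule measurable_completion) simp
  have gg0: "AE x in lebesgue. g x = g0 x"
    using eq vb'
  proof eventually_elim
    case (elim x)
    have [measurable]: "(\<lambda>y. K (x - y)) \<in> borel_measurable lebesgue"
      by (rule measurable_completion) simp
    have "g x = (LINT y|lebesgue. K (x - y) * (b y - b x))"
      unfolding elim using vb' vm bm by (intro integral_cong_AE) auto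
    also have "\<dots> = g0 x"
      unfolding g0_def by (rule integral_completion) simp
    finally show ?case .
  qed
  have "(LINT x|lebesgue. phi (q - 1) (v x) * g x) = (LINT x|lebesgue. phi (q - 1) (b x) * g0 x)"
    using vm bm g g0m vb' gg0
    by (intro integral_cong_AE) (auto intro!: borel_measurable_times measurable_compose[OF _ borel_measurable_phi])
  also have "\<dots> = (LINT x|lborel. phi (q - 1) (b x) * g0 x)"
    by (rule integral_completion) simp
  finally have I: "(LINT x|lebesgue. phi (q - 1) (v x) * g x) = (LINT x|lborel. phi (q - 1) (b x) * g0 x)" .
  define A where "A = (\<lambda>(x, y). K (x - y) * (phi (q - 1) (b x) * (b x - b y)))"
  have [measurable]: "A \<in> borel_measurable (lborel \<Otimes>\<^sub>M lborel)"
    unfolding A_def by measurable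
  have intA: "integrable (lborel \<Otimes>\<^sub>M lborel) A"
  proof (rule Bochner_Integration.integrable_bound)
    show "integrable (lborel \<Otimes>\<^sub>M lborel)
        (\<lambda>z. 2 * (case z of (x, y) \<Rightarrow> K (x - y) * \<bar>b x\<bar> powr q) + (case z of (x, y) \<Rightarrow> K (x - y) * \<bar>b y\<bar> powr q))"
      using K b by (intro Bochner_Integration.integrable_add integrable_mult_right integrable_kernel_product) auto
    show "AE z in lborel \<Otimes>\<^sub>M lborel. norm (A z) \<le> norm
        (2 * (case z of (x, y) \<Rightarrow> K (x - y) * \<bar>b x\<bar> powr q) + (case z of (x, y) \<Rightarrow> K (x - y) * \<bar>b y\<bar> powr q))"
    proof (rule AE_I2)
      fix z :: "(real^'n) \<times> (real^'n)"
      obtain x y :: "real^'n" where z: "z = (x, y)"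
        by (cases z)
      have "\<bar>phi (q - 1) (b x) * (b x - b y)\<bar> \<le> \<bar>phi (q - 1) (b x) * b x\<bar> + \<bar>phi (q - 1) (b x) * b y\<bar>"
        by (simp add: right_diff_distrib)
      also have "\<dots> \<le> 2 * \<bar>b x\<bar> powr q + \<bar>b y\<bar> powr q"
        using abs_phi_mult_le[OF assms(1), of 1 "b x" "b y"] by (simp add: phi_mult_self)
      finally have "K (x - y) * \<bar>phi (q - 1) (b x) * (b x - b y)\<bar> \<le> K (x - y) * (2 * \<bar>b x\<bar> powr q + \<bar>b y\<bar> powr q)"
        using K(3) by (intro mult_left_mono)
      then show "norm (A z) \<le> norm
          (2 * (case z of (x, y) \<Rightarrow> K (x - y) * \<bar>b x\<bar> powr q) + (case z of (x, y) \<Rightarrow> K (x - y) * \<bar>b y\<bar> powr q))"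
        using K(3)[of "x - y"] by (simp add: z A_def abs_mult distrib_left mult_ac)
    qed
  qed simp
  \<comment> \<open>The symmetrization of \<open>A\<close> is the integrand of the energy.\<close>
  define H where "H z = A z + A (prod.swap z)" for z
  have H: "H (x, y) = K (x - y) * (b x - b y) * (phi (q - 1) (b x) - phi (q - 1) (b y))" for x y
    using K(2)[of "x - y"] by (simp add: H_def A_def algebra_simps)
  have H_nonneg: "0 \<le> H z" for z
    using K(3) phi_mult_nonneg[of "q - 1"] assms(1) 
    by (cases z) (auto simp: H mult.assoc)
  have intA': "integrable (lborel \<Otimes>\<^sub>M lborel) (\<lambda>z. A (prod.swap z))"
    using lborel_pair.integrable_product_swap[OF intA] by (simp add: prod.swap_def case_prod_unfold)
  have "integrable (lborel \<Otimes>\<^sub>M lborel) H"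
    unfolding H_def using intA intA' by (rule Bochner_Integration.integrable_add)
  note intH = this
  have "integral\<^sup>L (lborel \<Otimes>\<^sub>M lborel) (\<lambda>z. A (prod.swap z)) = integral\<^sup>L (lborel \<Otimes>\<^sub>M lborel) A"
    using lborel_pair.integral_product_swap[of A] by (simp add: prod.swap_def case_prod_unfold)
  then have "integral\<^sup>L (lborel \<Otimes>\<^sub>M lborel) H = 2 * integral\<^sup>L (lborel \<Otimes>\<^sub>M lborel) A"
    unfolding H_def using intA intA' by simp
  also have "integral\<^sup>L (lborel \<Otimes>\<^sub>M lborel) A = (LINT x|lborel. (LINT y|lborel. A (x, y)))"
    by (rule lborel_pair.integral_fst'[OF intA, symmetric])
  also have "\<dots> = - (LINT x|lborel. phi (q - 1) (b x) * g0 x)"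
  proof -
    have "(LINT y|lborel. A (x, y)) = - (phi (q - 1) (b x) * g0 x)" for x
    proof -
      have "(LINT y|lborel. A (x, y)) = (LINT y|lborel. - phi (q - 1) (b x) * (K (x - y) * (b y - b x)))"
        by (simp add: A_def algebra_simps)
      also have "\<dots> = - phi (q - 1) (b x) * g0 x"
        unfolding g0_def by (rule integral_mult_right_zero)
      finally show ?thesis by simp
    qed
    then show ?thesis by simp
  qed
  finally have int_H: "integral\<^sup>L (lborel \<Otimes>\<^sub>M lborel) H = - 2 * (LINT x|lebesgue. phi (q - 1) (v x) * g x)"
    by (simp add: I)
  have "0 \<le> integral\<^sup>L (lborel \<Otimes>\<^sub>M lborel) H"
    using H_nonneg by simp
  then show "q * (LINT x|lebesgue. phi (q - 1) (v x) * g x) \<le> 0"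
    using assms(1) by (simp add: int_H mult_le_0_iff)
  have "energy q K v = energy q K b"
    by (rule energy_cong_AE[OF vb])
  also have "\<dots> = ennreal (q / 2) * (\<integral>\<^sup>+x. (\<integral>\<^sup>+y. ennreal (H (x, y)) \<partial>lborel) \<partial>lborel)"
    unfolding energy_def nn_integral_completion H ..
  also have "(\<integral>\<^sup>+x. (\<integral>\<^sup>+y. ennreal (H (x, y)) \<partial>lborel) \<partial>lborel) = (\<integral>\<^sup>+z. ennreal (H z) \<partial>(lborel \<Otimes>\<^sub>M lborel))"
    using borel_measurable_integrable[OF intH] by (intro lborel.nn_integral_fst) simp
  also have "\<dots> = ennreal (integral\<^sup>L (lborel \<Otimes>\<^sub>M lborel) H)"
    using intH H_nonneg by (intro nn_integral_eq_integral) auto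
  also have "ennreal (q / 2) * \<dots> = ennreal (q / 2 * integral\<^sup>L (lborel \<Otimes>\<^sub>M lborel) H)"
    using assms(1) H_nonneg by (subst ennreal_mult) auto
  also have "q / 2 * integral\<^sup>L (lborel \<Otimes>\<^sub>M lborel) H = - (q * (LINT x|lebesgue. phi (q - 1) (v x) * g x))"
    by (simp add: int_H)
  finally show "energy q K v = ennreal (- (q * (LINT x|lebesgue. phi (q - 1) (v x) * g x)))" .
qed

section \<open>Integrability of the rescaled kernel\<close>

lemma prod_Basis_vec:
  fixes f :: "real^'n \<Rightarrow> 'b::comm_monoid_mult"
  shows "(\<Prod>b\<in>Basis. f b) = (\<Prod>i\<in>UNIV. f (axis i 1))"
proof -
  have Basis: "(Basis :: (real^'n) set) = range (\<lambda>i. axis i 1)"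
    by (auto simp: Basis_vec_def)
  have inj: "inj (\<lambda>i. axis i 1 :: real^'n)"
    by (auto simp: inj_on_def axis_eq_axis)
  show ?thesis
    unfolding Basis by (subst prod.reindex[OF inj]) simp
qed

lemma emeasure_box_cart:
  fixes l u :: "real^'n"
  assumes "\<And>i. l $ i \<le> u $ i"
  shows "emeasure lborel (box l u) = (\<Prod>i\<in>UNIV. u $ i - l $ i)"
proof -
  have "emeasure lborel (box l u) = (\<Prod>b\<in>Basis. (u - l) \<bullet> b)"
    using assms by (intro emeasure_lborel_box) (auto simp: Basis_vec_def inner_axis)
  also have "(\<Prod>b\<in>Basis. (u - l) \<bullet> b) = (\<Prod>i\<in>UNIV. u $ i - l $ i)"
    by (simp add: prod_Basis_vec inner_axis)
  finally show ?thesis .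
qed

lemma lborel_distr_permute:
  fixes \<pi> :: "'n::finite \<Rightarrow> 'n"
  assumes "bij \<pi>"
  shows "distr lborel borel (\<lambda>z :: real^'n. \<chi> i. z $ \<pi> i) = lborel"
proof (rule lborel_eqI[symmetric])
  let ?T = "\<lambda>z :: real^'n. \<chi> i. z $ \<pi> i"
  have "continuous_on UNIV ?T"
    by (intro continuous_intros)
  then have [measurable]: "?T \<in> borel_measurable borel"
    by (rule borel_measurable_continuous_onI)
  fix l u :: "real^'n"
  assume "\<And>b. b \<in> Basis \<Longrightarrow> l \<bullet> b \<le> u \<bullet> b"
  then have lu: "l $ i \<le> u $ i" for i
    by (metis axis_in_Basis_iff Basis_real_def insertI1 cart_eq_inner_axis)
  let ?S = "\<lambda>z :: real^'n. \<chi> i. z $ inv \<pi> i"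
  have inv: "inv \<pi> (\<pi> i) = i" "\<pi> (inv \<pi> i) = i" for i
    using assms by (auto simp: bij_is_inj bij_is_surj surj_f_inv_f)
  have "?T -` box l u = box (?S l) (?S u)"
    by (auto simp: mem_box_cart) (metis inv)+
  then have "emeasure (distr lborel borel ?T) (box l u) = emeasure lborel (box (?S l) (?S u))"
    by (subst emeasure_distr) auto
  also have "\<dots> = (\<Prod>i\<in>UNIV. u $ inv \<pi> i - l $ inv \<pi> i)"
    using lu by (subst emeasure_box_cart) auto
  also have "(\<Prod>i\<in>UNIV. u $ inv \<pi> i - l $ inv \<pi> i) = (\<Prod>i\<in>UNIV. u $ i - l $ i)"
    using bij_imp_bij_inv[OF assms] by (rule prod.reindex_bij_betw)
  also have "\<dots> = (\<Prod>b\<in>Basis. (u - l) \<bullet> b)"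
    by (simp add: prod_Basis_vec inner_axis)
  finally show "emeasure (distr lborel borel ?T) (box l u) = (\<Prod>b\<in>Basis. (u - l) \<bullet> b)" .
qed simp

text \<open>
  By radial symmetry all the coordinates have the same second moment, hence \<open>\<integral> J(z) |z|\<^sup>2 dz\<close> is
  finite; near the origin \<open>J\<close> is bounded.
\<close>

lemma radially_symmetric_integrable:
  fixes J :: "real^'n \<Rightarrow> real"
  assumes cont: "continuous_on UNIV J" and rad: "radially_symmetric J" and nonneg: "\<And>z. 0 \<le> J z"
    and moment: "integrable lebesgue (\<lambda>z. J z * (z $ k)\<^sup>2)"
  shows "integrable lborel J"
proof -
  have [measurable]: "J \<in> borel_measurable borel"
    using cont by (rule borel_measurable_continuous_onI)
  have coord [measurable]: "(\<lambda>z :: real^'n. z $ i) \<in> borel_measurable borel" for i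
    by (intro borel_measurable_continuous_onI continuous_intros)
  have int_k: "integrable lborel (\<lambda>z. J z * (z $ k)\<^sup>2)"
    using moment by (subst (asm) integrable_completion) auto
  have int_i: "integrable lborel (\<lambda>z. J z * (z $ i)\<^sup>2)" for i
  proof -
    define \<pi> where "\<pi> = id(i := k, k := i)"
    have "bij \<pi>"
      by (rule o_bij[where g = \<pi>]) (auto simp: \<pi>_def fun_eq_iff)
    let ?T = "\<lambda>z :: real^'n. \<chi> i. z $ \<pi> i"
    have [measurable]: "?T \<in> borel_measurable borel"
      by (intro borel_measurable_continuous_onI continuous_intros)
    have "norm (?T z) = norm z" for z
      using sum.reindex_bij_betw[OF \<open>bij \<pi>\<close>, of "\<lambda>i. (z $ i)\<^sup>2"]
      by (simp add: norm_vec_def L2_set_def)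
    then have JT: "J (?T z) = J z" for z
      using rad unfolding radially_symmetric_def by blast
    have "integrable (distr lborel borel ?T) (\<lambda>z. J z * (z $ k)\<^sup>2)"
      using int_k by (simp only: lborel_distr_permute[OF \<open>bij \<pi>\<close>])
    then have "integrable lborel (\<lambda>z. J (?T z) * (?T z $ k)\<^sup>2)"
      by (subst (asm) integrable_distr_eq) auto
    then show ?thesis
      by (simp add: JT) (simp add: \<pi>_def)
  qed
  have "integrable lborel (\<lambda>z. indicator (cball 0 1) z *\<^sub>R J z)"
    by (intro borel_integrable_compact continuous_on_subset[OF cont]) auto
  then have "integrable lborel (\<lambda>z. indicator (cball 0 1) z *\<^sub>R J z + (\<Sum>i\<in>UNIV. J z * (z $ i)\<^sup>2))"
    using int_i by (intro Bochner_Integration.integrable_add Bochner_Integration.integrable_sum) auto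
  then show ?thesis
  proof (rule Bochner_Integration.integrable_bound)
    show "AE z in lborel. norm (J z) \<le> norm (indicator (cball 0 1) z *\<^sub>R J z + (\<Sum>i\<in>UNIV. J z * (z $ i)\<^sup>2))"
    proof (rule AE_I2)
      fix z :: "real^'n"
      have eq: "(\<Sum>i\<in>UNIV. J z * (z $ i)\<^sup>2) = J z * (norm z)\<^sup>2"
        by (simp add: norm_vec_def L2_set_def sum_nonneg sum_distrib_left)
      have "J z \<le> indicator (cball 0 1) z * J z + J z * (norm z)\<^sup>2"
      proof (cases "norm z \<le> 1")
        case False
        then have "1 \<le> (norm z)\<^sup>2"
          by (simp add: one_le_power)
        then have "J z * 1 \<le> J z * (norm z)\<^sup>2"
          using nonneg by (intro mult_left_mono) auto
        then show ?thesis
          using False by simp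
      qed (simp add: nonneg)
      then show "norm (J z) \<le> norm (indicator (cball 0 1) z *\<^sub>R J z + (\<Sum>i\<in>UNIV. J z * (z $ i)\<^sup>2))"
        using nonneg[of z] by (simp add: eq)
    qed
  qed simp
qed

lemma diffusivity_pos:
  fixes J :: "real^'n \<Rightarrow> real"
  assumes nonneg: "\<And>z. 0 \<le> J z" and "0 < r" "0 < R" and r: "\<And>z. norm z < R \<Longrightarrow> r \<le> J z"
    and moment: "integrable lebesgue (\<lambda>z. J z * (z $ k)\<^sup>2)"
  shows "0 < diffusivity k J"
proof -
  let ?I = "LINT z|lebesgue. J z * (z $ k)\<^sup>2"
  have "?I \<noteq> 0"
  proof
    assume "?I = 0"
    then have "AE z in lebesgue. J z * (z $ k)\<^sup>2 = 0"
      using moment nonneg by (subst (asm) integral_nonneg_eq_0_iff_AE) auto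
    then obtain Z where "Z \<in> null_sets lebesgue" "{z. J z * (z $ k)\<^sup>2 \<noteq> 0} \<subseteq> Z"
      by (auto simp: eventually_ae_filter)
    then have "negligible {z. J z * (z $ k)\<^sup>2 \<noteq> 0}"
      using negligible_iff_null_sets negligible_subset by blast
    moreover have "ball 0 R \<inter> {z. z $ k \<noteq> 0} \<subseteq> {z. J z * (z $ k)\<^sup>2 \<noteq> 0}"
      using r \<open>0 < r\<close> by force
    ultimately have "negligible (ball 0 R \<inter> {z :: real^'n. z $ k \<noteq> 0})"
      by (rule negligible_subset)
    moreover have "open (ball 0 R \<inter> {z :: real^'n. z $ k \<noteq> 0})"
      by (intro open_Int open_ball open_Collect_neq continuous_intros)
    moreover have "axis k (R / 2) \<in> ball 0 R \<inter> {z :: real^'n. z $ k \<noteq> 0}"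
      using \<open>0 < R\<close> by (simp add: norm_eq_sqrt_inner inner_axis_axis real_sqrt_divide)
    ultimately show False
      using open_not_negligible by blast
  qed
  moreover have "0 \<le> ?I"
    using nonneg by simp
  ultimately show ?thesis
    unfolding diffusivity_def by simp
qed

lemma integrable_rescaled_kernel:
  fixes J :: "real^'n \<Rightarrow> real"
  assumes [measurable]: "J \<in> borel_measurable borel" and "integrable lborel J" and "0 < \<epsilon>"
  shows "integrable lborel (rescaled_kernel k J \<epsilon>)"
proof -
  have "integrable lborel (\<lambda>z. J (z /\<^sub>R \<epsilon>))"
  proof (rule integrableI_bounded)
    have "(\<integral>\<^sup>+z. ennreal (norm (J (z /\<^sub>R \<epsilon>))) \<partial>lborel) =
        ennreal (\<bar>\<epsilon>\<bar> ^ DIM(real^'n)) * (\<integral>\<^sup>+z. ennreal (norm (J z)) \<partial>lborel)"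
      using nn_integral_lborel_scale[of "\<lambda>z. ennreal (norm (J (z /\<^sub>R \<epsilon>)))" \<epsilon>] \<open>0 < \<epsilon>\<close> by simp
    also have "\<dots> < \<infinity>"
      using assms(2) by (simp add: integrable_iff_bounded ennreal_mult_less_top)
    finally show "(\<integral>\<^sup>+z. ennreal (norm (J (z /\<^sub>R \<epsilon>))) \<partial>lborel) < \<infinity>" .
  qed simp
  then show ?thesis
    unfolding rescaled_kernel_def[abs_def] by (rule integrable_mult_right)
qed

section \<open>Integration of the differential inequality\<close>

text \<open>
  The integration of \<open>F' \<le> - min (A * F powr (1 + \<gamma>)) (B * F)\<close>: exponential decay as long as
  \<open>F powr \<gamma>\<close> exceeds \<open>B / A\<close>, algebraic decay afterwards.
\<close>

lemma decay_of_left_Dini: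
  fixes F :: "real \<Rightarrow> real"
  assumes pos: "0 < \<gamma>" "0 < A" "0 < B" "0 < F 0"
    and cont: "continuous_on {0..} F" and nonneg: "\<And>t. 0 \<le> F t"
    and dini: "\<And>s \<eta>. 0 < s \<Longrightarrow> 0 < \<eta> \<Longrightarrow> \<forall>\<^sub>F r in at_left s.
      F s - F r \<le> (- min (A * F s powr (1 + \<gamma>)) (B * F s) + \<eta>) * (s - r)"
    and t0: "t0 = max 0 (ln ((A / B) powr (1 / \<gamma>) * F 0) / B)" and "t0 \<le> t"
  shows "F t \<le> (F 0 powr (- \<gamma>) + \<gamma> * A * (t - t0)) powr (- 1 / \<gamma>)"
proof -
  \<comment> \<open>The level at which the two terms of the minimum agree.\<close>
  define Fs where "Fs = (B / A) powr (1 / \<gamma>)"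
  have "0 < Fs"
    using pos by (simp add: Fs_def)
  have Fs_powr: "Fs powr \<gamma> = B / A"
    using pos by (simp add: Fs_def powr_powr)
  have Fs_eq: "(A / B) powr (1 / \<gamma>) * F 0 = F 0 / Fs"
    using pos by (simp add: Fs_def powr_divide field_simps)
  have split: "(F s powr \<gamma> \<le> B / A \<longleftrightarrow> F s \<le> Fs)" "F s powr (1 + \<gamma>) = F s * F s powr \<gamma>" for s
    using powr_mono2[of \<gamma> "F s" Fs] powr_less_mono2[of \<gamma> Fs "F s"] nonneg[of s] \<open>0 < Fs\<close> pos
    unfolding Fs_powr by (auto simp: powr_add not_le[symmetric])
  have exp_regime: "B * F s \<le> A * F s powr (1 + \<gamma>)" if "Fs \<le> F s" for s
  proof -
    have "B / A \<le> F s powr \<gamma>"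
      using powr_mono2[of \<gamma> Fs "F s"] that pos \<open>0 < Fs\<close> by (simp add: Fs_powr)
    then have "B \<le> A * F s powr \<gamma>"
      using pos by (simp add: field_simps)
    then show ?thesis
      using mult_right_mono[of B "A * F s powr \<gamma>" "F s"] nonneg[of s] by (simp add: split mult_ac)
  qed
  have alg_regime: "A * F s powr (1 + \<gamma>) \<le> B * F s" if "F s \<le> Fs" for s
  proof -
    have "A * F s powr \<gamma> \<le> B"
      using that split(1)[of s] pos by (simp add: field_simps)
    then show ?thesis
      using mult_right_mono[of "A * F s powr \<gamma>" B "F s"] nonneg[of s] by (simp add: split mult_ac)
  qed
  have min_nonneg: "0 \<le> min (A * F s powr (1 + \<gamma>)) (B * F s)" for s
    using pos nonneg by simp
  have dini': "\<forall>\<^sub>F r in at_left s. F s - F r \<le> (D + \<eta>) * (s - r)"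
    if "0 < s" "0 < \<eta>" "- min (A * F s powr (1 + \<gamma>)) (B * F s) \<le> D" for s D \<eta>
  proof -
    have "\<forall>\<^sub>F r in at_left s. r < s"
      by (simp add: eventually_at_filter)
    then show ?thesis
      using dini[OF that(1,2)]
    proof eventually_elim
      case (elim r)
      have "(- min (A * F s powr (1 + \<gamma>)) (B * F s) + \<eta>) * (s - r) \<le> (D + \<eta>) * (s - r)"
        using that elim by (intro mult_right_mono) auto
      then show ?case
        using elim by linarith
    qed
  qed
  have mono: "F b \<le> F a" if "0 \<le> a" "a \<le> b" for a b
  proof (rule left_Dini_comparison[where f = F and b = b and y = "\<lambda>_. F a" and y' = "\<lambda>_. 0" and a = a])
    show "continuous_on {a..b} F"
      using that by (intro continuous_on_subset[OF cont]) auto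
    fix s \<eta> :: real
    assume "a < s" "0 < \<eta>"
    then show "\<forall>\<^sub>F r in at_left s. F s - F r \<le> (0 + \<eta>) * (s - r)"
      using that min_nonneg[of s] by (intro dini') auto
  qed (use that in auto)
  have "0 \<le> t0"
    by (simp add: t0)
  have "F t0 \<le> Fs"
  proof (cases "Fs \<le> F 0")
    case False
    then show ?thesis
      using mono[of 0 t0] \<open>0 \<le> t0\<close> by simp
  next
    case True
    have t0': "t0 = ln (F 0 / Fs) / B"
      using True \<open>0 < Fs\<close> pos by (simp add: t0 Fs_eq)
    have Fs_t0: "F 0 * exp (- B * t0) = Fs"
      using \<open>0 < Fs\<close> pos by (simp add: t0' exp_minus)
    have "F t0 \<le> F 0 * exp (- B * t0)"
    proof (rule left_Dini_comparison[where f = F and b = t0 and y = "\<lambda>s. F 0 * exp (- B * s)" and a = 0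
          and y' = "\<lambda>s. - B * (F 0 * exp (- B * s))"])
      show "continuous_on {0..t0} F"
        by (intro continuous_on_subset[OF cont]) auto
      fix s \<eta> :: real
      assume s: "0 < s" "s \<le> t0" "F 0 * exp (- B * s) < F s" "0 < \<eta>"
      have "F 0 * exp (- B * t0) \<le> F 0 * exp (- B * s)"
        using pos s by simp
      then have "Fs \<le> F s"
        using s Fs_t0 by linarith
      then have "min (A * F s powr (1 + \<gamma>)) (B * F s) = B * F s"
        by (intro min_absorb2 exp_regime)
      moreover have "B * (F 0 * exp (- B * s)) \<le> B * F s"
        using s pos by (intro mult_left_mono) auto
      ultimately show "\<forall>\<^sub>F r in at_left s. F s - F r \<le> (- B * (F 0 * exp (- B * s)) + \<eta>) * (s - r)"
        using s by (intro dini') auto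
    qed (use \<open>0 \<le> t0\<close> in \<open>auto intro!: continuous_intros derivative_eq_intros\<close>)
    then show ?thesis
      by (simp only: Fs_t0)
  qed
  define y where "y s = (F 0 powr (- \<gamma>) + \<gamma> * A * (s - t0)) powr (- 1 / \<gamma>)" for s
  have base: "0 < F 0 powr (- \<gamma>) + \<gamma> * A * (s - t0)" if "t0 \<le> s" for s
    using that pos by (intro add_pos_nonneg) auto
  have y_powr: "y s powr (1 + \<gamma>) = (F 0 powr (- \<gamma>) + \<gamma> * A * (s - t0)) powr (- 1 / \<gamma> - 1)" for s
  proof -
    have "- 1 / \<gamma> * (1 + \<gamma>) = - 1 / \<gamma> - 1"
      using pos by (simp add: field_simps)
    then show ?thesis
      by (simp only: y_def powr_powr)
  qed
  have "F t \<le> y t"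
  proof (rule left_Dini_comparison[where f = F and y = y and b = t and a = t0 and y' = "\<lambda>s. - (A * y s powr (1 + \<gamma>))"])
    show "t0 \<le> t" by fact
    show "continuous_on {t0..t} F"
      using \<open>0 \<le> t0\<close> by (intro continuous_on_subset[OF cont]) auto
    have "F 0 powr (- \<gamma>) + \<gamma> * A * (s - t0) \<noteq> 0" if "t0 \<le> s" for s
      using base[OF that] by simp
    then show "continuous_on {t0..t} y"
      unfolding y_def by (intro continuous_intros) auto
    show "F t0 \<le> y t0"
      using mono[of 0 t0] \<open>0 \<le> t0\<close> pos by (simp add: y_def powr_powr)
    fix s
    assume s: "t0 < s" "s \<le> t"
    show "(y has_real_derivative - (A * y s powr (1 + \<gamma>))) (at s)"
      unfolding y_powr unfolding y_def[abs_def] using pos base[of s] s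
      by (auto intro!: derivative_eq_intros)
    fix \<eta> :: real
    assume "y s < F s" "0 < \<eta>"
    have "F s \<le> Fs"
      using mono[of t0 s] \<open>F t0 \<le> Fs\<close> \<open>0 \<le> t0\<close> s by simp
    then have "min (A * F s powr (1 + \<gamma>)) (B * F s) = A * F s powr (1 + \<gamma>)"
      by (intro min_absorb1 alg_regime)
    moreover have "A * y s powr (1 + \<gamma>) \<le> A * F s powr (1 + \<gamma>)"
      using pos \<open>y s < F s\<close> by (intro mult_left_mono powr_mono2) (auto simp: y_def)
    ultimately show "\<forall>\<^sub>F r in at_left s. F s - F r \<le> (- (A * y s powr (1 + \<gamma>)) + \<eta>) * (s - r)"
      using s \<open>0 \<le> t0\<close> \<open>0 < \<eta>\<close> by (intro dini') auto
  qed
  then show ?thesis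
    by (simp add: y_def)
qed

section \<open>Decay of solutions\<close>

lemma L1p_C1_imp_Lq_diff:
  fixes u u' :: "real \<Rightarrow> real^'n \<Rightarrow> real"
  assumes "1 \<le> p" and "L1p_C1 p u u'" "0 \<le> t"
  shows "Lq_diff 1 u (u' t) t" and "Lq_diff p u (u' t) t"
proof -
  let ?e = "\<lambda>s x. (u s x - u t x) / (s - t) - u' t x"
  have lim: "((\<lambda>s. L1p_norm p (?e s)) \<longlongrightarrow> 0) (at t within {0..})"
    and mem: "\<forall>s\<ge>0. L1p_mem p (u s)" "L1p_mem p (u' t)"
    using assms by (auto simp: L1p_C1_def)
  have nonneg: "0 \<le> Lq_norm q f" for q and f :: "real^'n \<Rightarrow> real"
    by (simp add: Lq_norm_def)
  have diff: "Lq_diff q u (u' t) t"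
    if q: "1 \<le> q" "\<And>f :: real^'n \<Rightarrow> real. Lq_norm q f \<le> L1p_norm p f" "\<And>f :: real^'n \<Rightarrow> real. L1p_mem p f \<Longrightarrow> Lq_mem q f" for q
  proof -
    have "((\<lambda>s. Lq_norm q (?e s)) \<longlongrightarrow> 0) (at t within {0..})"
      by (rule tendsto_sandwich[OF _ _ tendsto_const lim])
        (intro always_eventually allI nonneg q(2))+
    then have "((\<lambda>s. Lq_norm q (?e s) powr q) \<longlongrightarrow> 0) (at t within {0..})"
      using q by (intro tendsto_zero_powrI[where b = q]) (auto simp: nonneg)
    moreover have "Lq_norm q f powr q = Lq_pow q f" for f :: "real^'n \<Rightarrow> real"
      using Lq_norm_powr[of q f 1] q by simp
    ultimately show ?thesis
      using mem q by (simp add: Lq_diff_def)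
  qed
  show "Lq_diff 1 u (u' t) t"
    using nonneg[of p] by (intro diff) (auto simp: L1p_norm_def L1p_mem_def)
  show "Lq_diff p u (u' t) t"
    using nonneg[of 1] assms(1) by (intro diff) (auto simp: L1p_norm_def L1p_mem_def simp del: Lq_norm_1)
qed

lemma continuous_on_Lq_pow:
  assumes "1 \<le> q" "\<And>t. 0 \<le> t \<Longrightarrow> Lq_diff q u (u' t) t"
  shows "continuous_on {0..} (\<lambda>t. Lq_pow q (u t))"
  unfolding continuous_on_def using assms Lq_diff_imp_tendsto by fastforce

lemma solution_Lq_pow_left_Dini:
  fixes K :: "real^'n \<Rightarrow> real"
  assumes "1 \<le> q" and K: "K \<in> borel_measurable borel" "integrable lborel K" "\<And>z. K (- z) = K z" "\<And>z. 0 \<le> K z"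
    and diff: "Lq_diff q u u' t" and "0 < t"
    and eq: "AE x in lebesgue. u' x = (LINT y|lebesgue. K (x - y) * (u t y - u t x))"
    and e: "ennreal e \<le> energy q K (u t)" "0 \<le> e" and "0 < \<eta>"
  shows "\<forall>\<^sub>F s in at_left t. Lq_pow q (u t) - Lq_pow q (u s) \<le> (- e + \<eta>) * (t - s)"
proof (rule Lq_pow_left_Dini[OF assms(1) diff \<open>0 < t\<close> _ \<open>0 < \<eta>\<close>])
  have "Lq_mem q (u t)" "u' \<in> borel_measurable lebesgue"
    using diff \<open>0 < t\<close> by (auto simp: Lq_diff_def Lq_mem_def)
  note D = dissipation_identity[OF assms(1) K this eq]
  have "e \<le> - (q * (LINT x|lebesgue. phi (q - 1) (u t x) * u' x))"
    using e D by simp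
  then show "q * (LINT x|lebesgue. phi (q - 1) (u t x) * u' x) \<le> - e"
    by linarith
qed

text \<open>
  The decay estimate for an arbitrary even integrable kernel bounded below near the origin. The
  kernel enters only through \<open>\<rho>\<close> and \<open>P\<close>.
\<close>

lemma nonlocal_decay:
  fixes K u0 :: "real^'n \<Rightarrow> real" and u :: "real \<Rightarrow> real^'n \<Rightarrow> real"
  assumes "2 \<le> p" "0 < \<gamma>" "0 < C" and energy: "energy_inequality TYPE('n) p \<gamma> C"
    and K: "K \<in> borel_measurable borel" "integrable lborel K" "\<And>z. K (- z) = K z" "\<And>z. 0 \<le> K z"
    and "0 < \<rho>" "0 < P" and \<rho>: "\<And>z. norm z < P \<Longrightarrow> \<rho> \<le> K z"
    and u0: "L1p_mem p u0" and sol: "nonlocal_solution p K u0 u"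
    and t0: "t0 = max 0 (ln (P powr (2 / \<gamma>) * Lq_pow 1 u0 powr (- p) * Lq_pow p u0) / (C * \<rho> * P ^ CARD('n)))"
    and "t0 \<le> t"
  shows "Lq_pow p (u t) \<le> (Lq_pow p u0 powr (- \<gamma>) +
    \<gamma> * (C * \<rho> * P ^ (CARD('n) + 2) * Lq_pow 1 u0 powr (- p * \<gamma>)) * (t - t0)) powr (- 1 / \<gamma>)"
proof -
  obtain u' where C1: "L1p_C1 p u u'"
    and eq: "\<And>t. 0 < t \<Longrightarrow> AE x in lebesgue. u' t x = (LINT y|lebesgue. K (x - y) * (u t y - u t x))"
    and init: "AE x in lebesgue. u 0 x = u0 x"
    using sol unfolding nonlocal_solution_def by blast
  have diff: "Lq_diff q u (u' t) t" if "0 \<le> t" "q = 1 \<or> q = p" for q t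
    using L1p_C1_imp_Lq_diff[OF _ C1 that(1)] that(2) \<open>2 \<le> p\<close> by auto
  have mem: "L1p_mem p (u t)" if "0 \<le> t" for t
    using C1 that by (simp add: L1p_C1_def)
  have cont: "continuous_on {0..} (\<lambda>t. Lq_pow q (u t))" if "q = 1 \<or> q = p" for q
    using diff that \<open>2 \<le> p\<close> by (intro continuous_on_Lq_pow[where u' = u']) auto
  have init_pow: "Lq_pow q (u 0) = Lq_pow q u0" for q
  proof -
    have "u 0 \<in> borel_measurable lebesgue" "u0 \<in> borel_measurable lebesgue"
      using mem[of 0] u0 by (auto simp: L1p_mem_def Lq_mem_def)
    then show ?thesis
      unfolding Lq_pow_def using init by (intro integral_cong_AE) auto
  qed
  have anti: "Lq_pow q (u b) \<le> Lq_pow q u0" if "0 \<le> b" "q = 1 \<or> q = p" for q b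
    unfolding init_pow[symmetric]
  proof (rule left_Dini_comparison[where f = "\<lambda>t. Lq_pow q (u t)" and b = b and a = 0
        and y = "\<lambda>_. Lq_pow q (u 0)" and y' = "\<lambda>_. 0"])
    show "continuous_on {0..b} (\<lambda>t. Lq_pow q (u t))"
      using that by (intro continuous_on_subset[OF cont]) auto
    fix s \<eta> :: real
    assume "0 < s" "0 < \<eta>"
    then show "\<forall>\<^sub>F r in at_left s. Lq_pow q (u s) - Lq_pow q (u r) \<le> (0 + \<eta>) * (s - r)"
      using that \<open>2 \<le> p\<close> solution_Lq_pow_left_Dini[where e = 0 and q = q, OF _ K diff _ eq, of s \<eta>]
      by auto
  qed (use that in auto)
  define M where "M = Lq_pow 1 u0"
  define F where "F t = Lq_pow p (u t)" for t
  have F0: "Lq_pow p u0 = F 0"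
    by (simp add: F_def init_pow)
  have "0 \<le> t"
    using \<open>t0 \<le> t\<close> t0 by simp
  define A where "A = C * \<rho> * P ^ (CARD('n) + 2) * M powr (- p * \<gamma>)"
  define B where "B = C * \<rho> * P ^ CARD('n)"
  have mass_pos: "0 < Lq_pow 1 (u s)" if "0 < F s" "0 \<le> s" for s
  proof -
    have "Lq_mem 1 (u s)" "Lq_mem p (u s)"
      using mem[OF that(2)] by (auto simp: L1p_mem_def)
    then have "Lq_pow 1 (u s) \<noteq> 0"
      using that(1) Lq_pow_eq_0_iff[of 1 "u s"] Lq_pow_eq_0_iff[of p "u s"] by (auto simp: F_def)
    then show ?thesis
      using Lq_pow_nonneg[of 1 "u s"] by linarith
  qed
  show ?thesis
  proof (cases "F 0 = 0")
    case True
    then have "Lq_pow p (u t) = 0"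
      using anti[of t p] Lq_pow_nonneg[of p "u t"] \<open>0 \<le> t\<close> F0 by simp
    then show ?thesis by simp
  next
    case False
    then have "0 < F 0"
      using Lq_pow_nonneg[of p "u 0"] unfolding F_def by linarith
    then have "0 < M"
      using mass_pos[of 0] by (simp add: M_def init_pow)
    have "0 < A" "0 < B"
      using \<open>0 < C\<close> \<open>0 < \<rho>\<close> \<open>0 < P\<close> \<open>0 < M\<close> by (auto simp: A_def B_def)
    have "F t \<le> (F 0 powr (- \<gamma>) + \<gamma> * A * (t - t0)) powr (- 1 / \<gamma>)"
    proof (rule decay_of_left_Dini[where F = F, OF \<open>0 < \<gamma>\<close> \<open>0 < A\<close> \<open>0 < B\<close> \<open>0 < F 0\<close> _ _ _ _ \<open>t0 \<le> t\<close>])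
      show "continuous_on {0..} F"
        unfolding F_def[abs_def] by (rule cont) simp
      show "0 \<le> F s" for s
        by (simp add: F_def)
      have "(A / B) powr (1 / \<gamma>) = (P\<^sup>2 * M powr (- p * \<gamma>)) powr (1 / \<gamma>)"
        using \<open>0 < C\<close> \<open>0 < \<rho>\<close> \<open>0 < P\<close> by (simp add: A_def B_def power_add power2_eq_square mult.assoc)
      also have "\<dots> = P powr (2 / \<gamma>) * M powr (- p)"
        using \<open>0 < P\<close> \<open>0 < M\<close> \<open>0 < \<gamma>\<close> by (simp add: powr_mult powr_powr flip: powr_numeral)
      finally show "t0 = max 0 (ln ((A / B) powr (1 / \<gamma>) * F 0) / B)"
        by (simp add: t0 B_def M_def F0)
      fix s \<eta> :: real
      assume s: "0 < s" "0 < \<eta>"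
      define e where "e = min (A * F s powr (1 + \<gamma>)) (B * F s)"
      have "0 \<le> e"
        using \<open>0 < A\<close> \<open>0 < B\<close> by (simp add: e_def F_def)
      have norms: "Lq_norm p (u s) powr p = F s" "Lq_norm p (u s) powr (p * (1 + \<gamma>)) = F s powr (1 + \<gamma>)"
        using Lq_norm_powr[of p "u s" 1] Lq_norm_powr[of p "u s" "1 + \<gamma>"] \<open>2 \<le> p\<close> by (simp_all add: F_def)
      have "A * F s powr (1 + \<gamma>) \<le>
          C * \<rho> * (P ^ (CARD('n) + 2) * Lq_pow 1 (u s) powr (- p * \<gamma>) * F s powr (1 + \<gamma>))"
      proof (cases "F s = 0")
        \<comment> \<open>\<open>0 powr a = 0\<close>, so the powers of the mass can be compared only where it is positive.\<close>
        case False
        then have "0 < F s"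
          using Lq_pow_nonneg[of p "u s"] unfolding F_def by linarith
        then have "0 < Lq_pow 1 (u s)"
          using mass_pos s by simp
        moreover have "Lq_pow 1 (u s) \<le> M"
          unfolding M_def using s by (intro anti) auto
        ultimately have "M powr (- p * \<gamma>) \<le> Lq_pow 1 (u s) powr (- p * \<gamma>)"
          using \<open>2 \<le> p\<close> \<open>0 < \<gamma>\<close> by (intro powr_mono2') auto
        then have "(C * \<rho> * P ^ (CARD('n) + 2) * F s powr (1 + \<gamma>)) * M powr (- p * \<gamma>) \<le>
            (C * \<rho> * P ^ (CARD('n) + 2) * F s powr (1 + \<gamma>)) * Lq_pow 1 (u s) powr (- p * \<gamma>)"
          using \<open>0 < C\<close> \<open>0 < \<rho>\<close> \<open>0 < P\<close> by (intro mult_left_mono) auto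
        then show ?thesis
          by (simp only: A_def mult_ac)
      qed simp
      then have "e \<le> min (C * \<rho> * (P ^ (CARD('n) + 2) * Lq_pow 1 (u s) powr (- p * \<gamma>) * F s powr (1 + \<gamma>)))
          (C * \<rho> * (P ^ CARD('n) * F s))"
        unfolding e_def by (intro min.mono) (simp_all add: B_def)
      also have "\<dots> = C * \<rho> * min (P ^ (CARD('n) + 2) * Lq_pow 1 (u s) powr (- p * \<gamma>) * F s powr (1 + \<gamma>))
          (P ^ CARD('n) * F s)"
        using \<open>0 < C\<close> \<open>0 < \<rho>\<close> min_mult_distrib_left[of "C * \<rho>"] by simp
      finally have "ennreal e \<le> ennreal \<dots>"
        by (rule ennreal_leI)
      also have "\<dots> \<le> energy p K (u s)"
      proof -
        have "K \<in> borel_measurable lebesgue"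
          using K(1) by (intro measurable_completion) simp
        then show ?thesis
          using energy[unfolded energy_inequality_def, rule_format, of K \<rho> P "u s"]
            K(4) \<rho> \<open>0 < \<rho>\<close> \<open>0 < P\<close> mem[of s] s by (simp add: norms)
      qed
      finally show "\<forall>\<^sub>F r in at_left s. F s - F r \<le>
          (- min (A * F s powr (1 + \<gamma>)) (B * F s) + \<eta>) * (s - r)"
        unfolding e_def[symmetric] unfolding F_def using s \<open>0 \<le> e\<close> \<open>2 \<le> p\<close>
        by (intro solution_Lq_pow_left_Dini[OF _ K diff _ eq]) auto
    qed
    then show ?thesis
      by (simp add: F0 A_def M_def) (simp add: F_def)
  qed
qed

theorem theorem1p8:
  fixes p \<gamma> :: real
  assumes "2 \<le> p"
    and "\<gamma> = 2 / (real CARD('n::finite) * (p - 1))"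
  shows "(\<exists>C>0. energy_inequality TYPE('n) p \<gamma> C) \<and>
    (\<forall>C>0. energy_inequality TYPE('n) p \<gamma> C \<longrightarrow>
      (\<forall>(J :: real^'n \<Rightarrow> real) k r R \<epsilon> u0 u C1 t0 \<epsilon>0.
        smooth J \<and> radially_symmetric J \<and> (\<forall>z. 0 \<le> J z) \<and> 0 < J 0 \<and>
        0 < r \<and> 0 < R \<and> (\<forall>z. norm z < R \<longrightarrow> r \<le> J z) \<and>
        integrable lebesgue (\<lambda>z. J z * (z $ k)\<^sup>2) \<and>
        0 < \<epsilon> \<and> L1p_mem p u0 \<and>
        nonlocal_solution p (rescaled_kernel k J \<epsilon>) u0 u \<and>
        C1 = C * \<gamma> * r * R ^ (CARD('n) + 2) * diffusivity k J \<and>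
        t0 = max 0 (\<epsilon>\<^sup>2 / (C * r * R ^ CARD('n) * diffusivity k J) *
               ln (\<epsilon> powr (2 / \<gamma>) * R powr (2 / \<gamma>) * Lq_norm 1 u0 powr (- p) * Lq_norm p u0 powr p)) \<and>
        \<epsilon>0 = Lq_norm 1 u0 powr (\<gamma> * p / 2) / (R * Lq_norm p u0 powr (\<gamma> * p / 2)) \<longrightarrow>
        (\<forall>t\<ge>t0. Lq_norm p (u t) powr p \<le>
           (Lq_norm p u0 powr (- p * \<gamma>) + C1 * Lq_norm 1 u0 powr (- p * \<gamma>) * (t - t0)) powr (- 1 / \<gamma>)) \<and>
        (\<epsilon> < \<epsilon>0 \<longrightarrow> t0 = 0)))"
proof (intro conjI exists_energy_inequality[OF assms] allI impI; (elim conjE)?)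
  fix C :: real and J :: "real^'n \<Rightarrow> real" and k r R \<epsilon> u0 u C1 t0 \<epsilon>0
  assume "0 < C" and energy: "energy_inequality TYPE('n) p \<gamma> C"
    and "smooth J" and rad: "radially_symmetric J" and nonneg: "\<forall>z. 0 \<le> J z"
    and "0 < r" "0 < R" and r: "\<forall>z. norm z < R \<longrightarrow> r \<le> J z"
    and moment: "integrable lebesgue (\<lambda>z. J z * (z $ k)\<^sup>2)"
    and "0 < \<epsilon>" and u0: "L1p_mem p u0"
    and sol: "nonlocal_solution p (rescaled_kernel k J \<epsilon>) u0 u"
    and C1: "C1 = C * \<gamma> * r * R ^ (CARD('n) + 2) * diffusivity k J"
    and t0: "t0 = max 0 (\<epsilon>\<^sup>2 / (C * r * R ^ CARD('n) * diffusivity k J) *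
      ln (\<epsilon> powr (2 / \<gamma>) * R powr (2 / \<gamma>) * Lq_norm 1 u0 powr (- p) * Lq_norm p u0 powr p))"
    and \<epsilon>0: "\<epsilon>0 = Lq_norm 1 u0 powr (\<gamma> * p / 2) / (R * Lq_norm p u0 powr (\<gamma> * p / 2))"
  let ?c = "diffusivity k J"
  have c: "0 < ?c"
    using nonneg \<open>0 < r\<close> \<open>0 < R\<close> r moment by (intro diffusivity_pos[where r = r and R = R]) auto
  have \<gamma>: "0 < \<gamma>"
    using assms by simp
  have norms: "Lq_norm p f powr p = Lq_pow p f" "Lq_norm p f powr (- p * \<gamma>) = Lq_pow p f powr (- \<gamma>)"
    for f :: "real^'n \<Rightarrow> real"
    using Lq_norm_powr[of p f 1] Lq_norm_powr[of p f "- \<gamma>"] assms(1) by simp_all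
  {
    fix t
    assume "t0 \<le> t"
    define \<rho> where "\<rho> = ?c / \<epsilon> ^ (2 + CARD('n)) * r"
    have "0 < \<rho>" "0 < \<epsilon> * R"
      using c \<open>0 < r\<close> \<open>0 < R\<close> \<open>0 < \<epsilon>\<close> by (auto simp: \<rho>_def)
    have cont: "continuous_on UNIV J"
      using \<open>smooth J\<close> unfolding smooth_def by (metis C_k.simps(1))
    then have J [measurable]: "J \<in> borel_measurable borel"
      by (rule borel_measurable_continuous_onI)
    have int: "integrable lborel J"
      using cont rad nonneg moment by (intro radially_symmetric_integrable) auto
    have K: "rescaled_kernel k J \<epsilon> \<in> borel_measurable borel"
      "integrable lborel (rescaled_kernel k J \<epsilon>)"
      "rescaled_kernel k J \<epsilon> (- z) = rescaled_kernel k J \<epsilon> z"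
      "0 \<le> rescaled_kernel k J \<epsilon> z"
      "norm z < \<epsilon> * R \<Longrightarrow> \<rho> \<le> rescaled_kernel k J \<epsilon> z" for z
    proof -
      show "rescaled_kernel k J \<epsilon> \<in> borel_measurable borel"
        unfolding rescaled_kernel_def[abs_def] by measurable
      show "integrable lborel (rescaled_kernel k J \<epsilon>)"
        using J int \<open>0 < \<epsilon>\<close> by (rule integrable_rescaled_kernel)
      have "J ((- z) /\<^sub>R \<epsilon>) = J (z /\<^sub>R \<epsilon>)"
        using rad unfolding radially_symmetric_def by (metis norm_minus_cancel scaleR_minus_right)
      then show "rescaled_kernel k J \<epsilon> (- z) = rescaled_kernel k J \<epsilon> z"
        by (simp add: rescaled_kernel_def)
      show "0 \<le> rescaled_kernel k J \<epsilon> z"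
        using c nonneg \<open>0 < \<epsilon>\<close> by (simp add: rescaled_kernel_def)
      assume "norm z < \<epsilon> * R"
      then have "norm (z /\<^sub>R \<epsilon>) < R"
        using \<open>0 < \<epsilon>\<close> by (simp add: field_simps)
      then show "\<rho> \<le> rescaled_kernel k J \<epsilon> z"
        unfolding rescaled_kernel_def \<rho>_def using r c \<open>0 < \<epsilon>\<close> by (intro mult_left_mono) auto
    qed
    have B: "C * \<rho> * (\<epsilon> * R) ^ CARD('n) = C * r * R ^ CARD('n) * ?c / \<epsilon>\<^sup>2"
      using \<open>0 < \<epsilon>\<close> by (simp add: \<rho>_def power_add power_mult_distrib power2_eq_square field_simps)
    have A: "\<gamma> * (C * \<rho> * (\<epsilon> * R) ^ (CARD('n) + 2) * m) = C1 * m" for m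
      using \<open>0 < \<epsilon>\<close> by (simp add: C1 \<rho>_def power_add power_mult_distrib power2_eq_square field_simps)
    have "t0 = max 0 (ln ((\<epsilon> * R) powr (2 / \<gamma>) * Lq_pow 1 u0 powr (- p) * Lq_pow p u0) /
        (C * \<rho> * (\<epsilon> * R) ^ CARD('n)))"
      using \<open>0 < \<epsilon>\<close> \<open>0 < R\<close> by (simp add: t0 B norms powr_mult mult.commute[of "\<epsilon>\<^sup>2"])
    from nonlocal_decay[OF assms(1) \<gamma> \<open>0 < C\<close> energy K(1-4) \<open>0 < \<rho>\<close> \<open>0 < \<epsilon> * R\<close> K(5) u0 sol this \<open>t0 \<le> t\<close>]
    show "Lq_norm p (u t) powr p \<le>
        (Lq_norm p u0 powr (- p * \<gamma>) + C1 * Lq_norm 1 u0 powr (- p * \<gamma>) * (t - t0)) powr (- 1 / \<gamma>)"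
      unfolding A norms Lq_norm_1 .
  }
  {
    assume "\<epsilon> < \<epsilon>0"
    define m where "m = Lq_norm 1 u0"
    define n where "n = Lq_norm p u0"
    have "m \<noteq> 0" "n \<noteq> 0"
      using \<open>\<epsilon> < \<epsilon>0\<close> \<open>0 < \<epsilon>\<close> by (auto simp: \<epsilon>0 m_def n_def)
    moreover have "0 \<le> m" "0 \<le> n"
      by (simp_all add: m_def n_def Lq_norm_eq)
    ultimately have "0 < m" "0 < n"
      by simp_all
    have "\<epsilon> * R < m powr (\<gamma> * p / 2) / n powr (\<gamma> * p / 2)"
      using \<open>\<epsilon> < \<epsilon>0\<close> \<open>0 < R\<close> \<open>0 < n\<close> unfolding \<epsilon>0 m_def[symmetric] n_def[symmetric]
      by (simp add: field_simps)
    then have "(\<epsilon> * R) powr (2 / \<gamma>) < (m powr (\<gamma> * p / 2) / n powr (\<gamma> * p / 2)) powr (2 / \<gamma>)"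
      using \<open>0 < \<epsilon>\<close> \<open>0 < R\<close> \<gamma> by (intro powr_less_mono2) auto
    also have "\<dots> = m powr p / n powr p"
      using \<gamma> by (simp add: powr_divide powr_powr)
    finally have "(\<epsilon> * R) powr (2 / \<gamma>) * m powr (- p) * n powr p < 1"
      using \<open>0 < m\<close> \<open>0 < n\<close> by (simp add: powr_minus field_simps)
    then have "\<epsilon> powr (2 / \<gamma>) * R powr (2 / \<gamma>) * m powr (- p) * n powr p < 1"
      using \<open>0 < \<epsilon>\<close> \<open>0 < R\<close> by (simp add: powr_mult)
    then have "ln (\<epsilon> powr (2 / \<gamma>) * R powr (2 / \<gamma>) * m powr (- p) * n powr p) \<le> 0"
      using \<open>0 < \<epsilon>\<close> \<open>0 < R\<close> \<open>0 < m\<close> \<open>0 < n\<close> by (subst ln_le_zero_iff) auto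
    moreover have "0 \<le> \<epsilon>\<^sup>2 / (C * r * R ^ CARD('n) * ?c)"
      using \<open>0 < C\<close> \<open>0 < r\<close> \<open>0 < R\<close> c by simp
    ultimately show "t0 = 0"
      unfolding t0 m_def n_def by (intro max_absorb1 mult_nonneg_nonpos)
  }
qed

end
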